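(* Let $G$ be a Lie group with identity $e$ and Lie algebra $\mathfrak g\cong T_eG$, and let $g$ be a bi-invariant Riemannian metric on $G$, with $\langle\cdot,\cdot\rangle$ the inner product it defines on $\mathfrak g$. Let $\tilde X$ be a left invariant vector field on $G$ which is parallel with respect to (the Levi-Civita connection of) $g$ and satisfies $\sqrt{g(\tilde X,\tilde X)}<\frac12$, and put $X:=\tilde X_e$. Let $F=\frac{\alpha^2}{\alpha-\beta}$ be the Matsumoto metric on $G$ induced by $g$ and $\tilde X$. Let $(P,Y)$ be a flag in $T_eG$ such that $\{Y,U\}$ is an orthonormal basis of $P$ with respect to $\langle\cdot,\cdot\rangle$. Then the flag curvature of $F$ for the flag $(P,Y)$ is $$K(P,Y)=\frac{-(1-\langle Y,X\rangle)^2}{4(1-\langle Y,X\rangle)(1-2\langle Y,X\rangle)+8\langle U,X\rangle^2}\Big\{\langle[[U,Y],Y],U\rangle(1-\langle Y,X\rangle)(1-2\langle Y,X\rangle)+3\langle[[U,Y],Y],X\rangle\langle U,X\rangle\Big\}.$$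
   Context: The Matsumoto metric induced by a Riemannian metric $g$ and a vector field $\tilde X$ on a manifold $M$ is $$F(x,y)=\frac{\alpha(x,y)^2}{\alpha(x,y)-\beta(x,y)},\qquad \alpha(x,y)=\sqrt{g_x(y,y)},\quad \beta(x,y)=g_x(\tilde X(x),y).$$ For a Finsler metric $F$, a flag $(P,Y)$ at $x$ consists of a 2-plane $P\subset T_xM$ and a nonzero $Y\in P$. With $P=\mathrm{span}\{U,Y\}$, the flag curvature is $$K(P,Y)=\frac{g_Y(R(U,Y)Y,U)}{g_Y(Y,Y)\,g_Y(U,U)-g_Y(Y,U)^2},\qquad g_Y(U,V)=\frac12\frac{\partial^2}{\partial s\,\partial t}F^2(Y+sU+tV)\Big|_{s=t=0},$$ where $R(U,Y)Y=\nabla_U\nabla_YY-\nabla_Y\nabla_UY-\nabla_{[U,Y]}Y$ and $\nabla$ is the Chern connection of $F$ (with reference vector $Y$). Brackets are those of $\mathfrak g$. *)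

theory Defs
  imports "HOL-Analysis.Analysis" "HOL-Algebra.Group"
begin

section \<open>Smooth functions on open subsets of Euclidean spaces\<close>

fun k_smooth_on ::
  "nat \<Rightarrow> ('a::euclidean_space \<Rightarrow> 'b::euclidean_space) \<Rightarrow> 'a set \<Rightarrow> bool" where
  "k_smooth_on 0 f S = continuous_on S f"
| "k_smooth_on (Suc k) f S =
     ((\<forall>x\<in>S. f differentiable (at x)) \<and>
      (\<forall>v. k_smooth_on k (\<lambda>x. frechet_derivative f (at x) v) S))"

text \<open>Only used for open \<open>S\<close>.\<close>
definition smooth_on :: "('a::euclidean_space \<Rightarrow> 'b::euclidean_space) \<Rightarrow> 'a set \<Rightarrow> bool" where
  "smooth_on f S \<longleftrightarrow> (\<forall>k. k_smooth_on k f S)"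


section \<open>Smooth manifolds and Lie groups\<close>

text \<open>A chart is a pair of a domain and a coordinate map on it. The Euclidean
  model space \<open>'e\<close> fixes the dimension of the manifold.\<close>
type_synonym ('m, 'e) chart = "'m set \<times> ('m \<Rightarrow> 'e)"

abbreviation chart_inv :: "('m, 'e) chart \<Rightarrow> 'e \<Rightarrow> 'm" where
  "chart_inv c \<equiv> inv_into (fst c) (snd c)"

abbreviation chart_image :: "('m, 'e) chart \<Rightarrow> 'e set" where
  "chart_image c \<equiv> snd c ` fst c"

definition smooth_manifold :: "'m topology \<Rightarrow> ('m, 'e::euclidean_space) chart set \<Rightarrow> bool" where
  "smooth_manifold T A \<longleftrightarrow>
     Hausdorff_space T \<and> second_countable T \<and>
     (\<Union>c\<in>A. fst c) = topspace T \<and>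
     (\<forall>c\<in>A. openin T (fst c) \<and> open (chart_image c) \<and>
        homeomorphic_map (subtopology T (fst c)) (top_of_set (chart_image c)) (snd c)) \<and>
     (\<forall>c\<in>A. \<forall>d\<in>A. smooth_on (snd d \<circ> chart_inv c) (snd c ` (fst c \<inter> fst d)))"

definition smooth_map ::
  "'m topology \<Rightarrow> ('m, 'e::euclidean_space) chart set \<Rightarrow>
   'n topology \<Rightarrow> ('n, 'f::euclidean_space) chart set \<Rightarrow> ('m \<Rightarrow> 'n) \<Rightarrow> bool" where
  "smooth_map T A T' A' f \<longleftrightarrow>
     continuous_map T T' f \<and>
     (\<forall>c\<in>A. \<forall>d\<in>A'.
        smooth_on (snd d \<circ> f \<circ> chart_inv c) (snd c ` {p \<in> fst c. f p \<in> fst d}))"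

definition prod_atlas ::
  "('m, 'e) chart set \<Rightarrow> ('n, 'f) chart set \<Rightarrow> ('m \<times> 'n, 'e \<times> 'f) chart set" where
  "prod_atlas A B = {(fst c \<times> fst d, map_prod (snd c) (snd d)) | c d. c \<in> A \<and> d \<in> B}"

definition lie_group ::
  "('m, 'r) monoid_scheme \<Rightarrow> 'm topology \<Rightarrow> ('m, 'e::euclidean_space) chart set \<Rightarrow> bool" where
  "lie_group G T A \<longleftrightarrow>
     group G \<and> topspace T = carrier G \<and> smooth_manifold T A \<and>
     smooth_map (prod_topology T T) (prod_atlas A A) T A (\<lambda>(a, b). a \<otimes>\<^bsub>G\<^esub> b) \<and>
     smooth_map T A T A (\<lambda>a. inv\<^bsub>G\<^esub> a)"


section \<open>Tangent vectors and vector fields\<close>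

text \<open>The tangent space at \<open>p\<close> is identified with the model space \<open>'e\<close> by means of a preferred
  chart \<open>chart_at A p\<close>: the element \<open>v\<close> of \<open>'e\<close> stands for the tangent vector at \<open>p\<close> whose
  coordinate vector in that chart is \<open>v\<close>. The maps \<open>to_chart A c p\<close> and \<open>from_chart A c p\<close>
  convert between this representation and the coordinate vector in another chart \<open>c\<close> at \<open>p\<close>.\<close>

definition chart_at :: "('m, 'e) chart set \<Rightarrow> 'm \<Rightarrow> ('m, 'e) chart" where
  "chart_at A p = (SOME c. c \<in> A \<and> p \<in> fst c)"

definition tangent_map ::
  "('m, 'e::euclidean_space) chart set \<Rightarrow> ('n, 'f::euclidean_space) chart set \<Rightarrow>
   ('m \<Rightarrow> 'n) \<Rightarrow> 'm \<Rightarrow> 'e \<Rightarrow> 'f" where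
  "tangent_map A B f p =
     frechet_derivative (snd (chart_at B (f p)) \<circ> f \<circ> chart_inv (chart_at A p))
       (at (snd (chart_at A p) p))"

definition to_chart ::
  "('m, 'e::euclidean_space) chart set \<Rightarrow> ('m, 'e) chart \<Rightarrow> 'm \<Rightarrow> 'e \<Rightarrow> 'e" where
  "to_chart A c p =
     frechet_derivative (snd c \<circ> chart_inv (chart_at A p)) (at (snd (chart_at A p) p))"

definition from_chart ::
  "('m, 'e::euclidean_space) chart set \<Rightarrow> ('m, 'e) chart \<Rightarrow> 'm \<Rightarrow> 'e \<Rightarrow> 'e" where
  "from_chart A c p =
     frechet_derivative (snd (chart_at A p) \<circ> chart_inv c) (at (snd c p))"

definition field_coord ::
  "('m, 'e::euclidean_space) chart set \<Rightarrow> ('m, 'e) chart \<Rightarrow> ('m \<Rightarrow> 'e) \<Rightarrow> 'e \<Rightarrow> 'e" where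
  "field_coord A c X x = to_chart A c (chart_inv c x) (X (chart_inv c x))"

definition smooth_vector_field ::
  "('m, 'e::euclidean_space) chart set \<Rightarrow> ('m \<Rightarrow> 'e) \<Rightarrow> bool" where
  "smooth_vector_field A X \<longleftrightarrow> (\<forall>c\<in>A. smooth_on (field_coord A c X) (chart_image c))"

text \<open>Coordinate expression of the bracket with \<open>[V, W] f = V (W f) - W (V f)\<close>.\<close>
definition coord_bracket ::
  "('e::euclidean_space \<Rightarrow> 'e) \<Rightarrow> ('e \<Rightarrow> 'e) \<Rightarrow> 'e \<Rightarrow> 'e" where
  "coord_bracket V W x = frechet_derivative W (at x) (V x) - frechet_derivative V (at x) (W x)"

definition field_bracket ::
  "('m, 'e::euclidean_space) chart set \<Rightarrow> ('m \<Rightarrow> 'e) \<Rightarrow> ('m \<Rightarrow> 'e) \<Rightarrow> 'm \<Rightarrow> 'e" where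
  "field_bracket A V W p =
     (let c = chart_at A p
      in coord_bracket (field_coord A c V) (field_coord A c W) (snd c p))"

definition left_invariant ::
  "('m, 'r) monoid_scheme \<Rightarrow> ('m, 'e::euclidean_space) chart set \<Rightarrow> ('m \<Rightarrow> 'e) \<Rightarrow> bool" where
  "left_invariant G A X \<longleftrightarrow>
     (\<forall>a\<in>carrier G. \<forall>p\<in>carrier G.
        tangent_map A A (\<lambda>q. a \<otimes>\<^bsub>G\<^esub> q) p (X p) = X (a \<otimes>\<^bsub>G\<^esub> p))"

definition left_extension ::
  "('m, 'r) monoid_scheme \<Rightarrow> ('m, 'e::euclidean_space) chart set \<Rightarrow> 'e \<Rightarrow> 'm \<Rightarrow> 'e" where
  "left_extension G A u p = tangent_map A A (\<lambda>q. p \<otimes>\<^bsub>G\<^esub> q) \<one>\<^bsub>G\<^esub> u"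

text \<open>The bracket of the Lie algebra, transported to the tangent space at the identity.\<close>
definition lie_bracket ::
  "('m, 'r) monoid_scheme \<Rightarrow> ('m, 'e::euclidean_space) chart set \<Rightarrow> 'e \<Rightarrow> 'e \<Rightarrow> 'e" where
  "lie_bracket G A u v =
     field_bracket A (left_extension G A u) (left_extension G A v) \<one>\<^bsub>G\<^esub>"


section \<open>Riemannian metrics\<close>

definition metric_coord ::
  "('m, 'e::euclidean_space) chart set \<Rightarrow> ('m, 'e) chart \<Rightarrow> ('m \<Rightarrow> 'e \<Rightarrow> 'e \<Rightarrow> real) \<Rightarrow>
   'e \<Rightarrow> 'e \<Rightarrow> 'e \<Rightarrow> real" where
  "metric_coord A c g x u v =
     (let p = chart_inv c x in g p (from_chart A c p u) (from_chart A c p v))"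

definition riemannian_metric ::
  "'m topology \<Rightarrow> ('m, 'e::euclidean_space) chart set \<Rightarrow> ('m \<Rightarrow> 'e \<Rightarrow> 'e \<Rightarrow> real) \<Rightarrow> bool" where
  "riemannian_metric T A g \<longleftrightarrow>
     (\<forall>p\<in>topspace T. bilinear (g p) \<and> (\<forall>u v. g p u v = g p v u) \<and> (\<forall>u. u \<noteq> 0 \<longrightarrow> g p u u > 0)) \<and>
     (\<forall>c\<in>A. \<forall>u v. smooth_on (\<lambda>x. metric_coord A c g x u v) (chart_image c))"

definition bi_invariant ::
  "('m, 'r) monoid_scheme \<Rightarrow> ('m, 'e::euclidean_space) chart set \<Rightarrow>
   ('m \<Rightarrow> 'e \<Rightarrow> 'e \<Rightarrow> real) \<Rightarrow> bool" where
  "bi_invariant G A g \<longleftrightarrow>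
     (\<forall>a\<in>carrier G. \<forall>p\<in>carrier G. \<forall>u v.
        g (a \<otimes>\<^bsub>G\<^esub> p) (tangent_map A A (\<lambda>q. a \<otimes>\<^bsub>G\<^esub> q) p u)
                       (tangent_map A A (\<lambda>q. a \<otimes>\<^bsub>G\<^esub> q) p v) = g p u v \<and>
        g (p \<otimes>\<^bsub>G\<^esub> a) (tangent_map A A (\<lambda>q. q \<otimes>\<^bsub>G\<^esub> a) p u)
                       (tangent_map A A (\<lambda>q. q \<otimes>\<^bsub>G\<^esub> a) p v) = g p u v)"

text \<open>Christoffel symbols \<open>\<Gamma> u v\<close> at \<open>x\<close> of the Levi-Civita connection of the coordinate metric
  \<open>h\<close>, i.e. of the unique torsion-free metric connection.\<close>
definition levi_civita_symbol ::
  "('e::euclidean_space \<Rightarrow> 'e \<Rightarrow> 'e \<Rightarrow> real) \<Rightarrow> 'e \<Rightarrow> 'e \<Rightarrow> 'e \<Rightarrow> 'e" where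
  "levi_civita_symbol h x =
     (THE \<Gamma>. bilinear \<Gamma> \<and> (\<forall>u v. \<Gamma> u v = \<Gamma> v u) \<and>
        (\<forall>u v w. frechet_derivative (\<lambda>z. h z v w) (at x) u = h x (\<Gamma> u v) w + h x v (\<Gamma> u w)))"

definition levi_civita_deriv ::
  "('m, 'e::euclidean_space) chart set \<Rightarrow> ('m \<Rightarrow> 'e \<Rightarrow> 'e \<Rightarrow> real) \<Rightarrow> 'm \<Rightarrow> 'e \<Rightarrow>
   ('m \<Rightarrow> 'e) \<Rightarrow> 'e" where
  "levi_civita_deriv A g p v X =
     (let c = chart_at A p; x = snd c p
      in frechet_derivative (field_coord A c X) (at x) v
         + levi_civita_symbol (metric_coord A c g) x v (field_coord A c X x))"

definition parallel_field ::
  "'m topology \<Rightarrow> ('m, 'e::euclidean_space) chart set \<Rightarrow> ('m \<Rightarrow> 'e \<Rightarrow> 'e \<Rightarrow> real) \<Rightarrow>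
   ('m \<Rightarrow> 'e) \<Rightarrow> bool" where
  "parallel_field T A g X \<longleftrightarrow> (\<forall>p\<in>topspace T. \<forall>v. levi_civita_deriv A g p v X = 0)"


section \<open>Finsler metrics: fundamental tensor, Chern connection, flag curvature\<close>

definition finsler_coord ::
  "('m, 'e::euclidean_space) chart set \<Rightarrow> ('m, 'e) chart \<Rightarrow> ('m \<Rightarrow> 'e \<Rightarrow> real) \<Rightarrow>
   'e \<Rightarrow> 'e \<Rightarrow> real" where
  "finsler_coord A c F x y = (let p = chart_inv c x in F p (from_chart A c p y))"

text \<open>The form \<open>g\<^sub>Y(U, V)\<close> of a Minkowski norm \<open>N\<close>.\<close>
definition fundamental_tensor ::
  "('e::euclidean_space \<Rightarrow> real) \<Rightarrow> 'e \<Rightarrow> 'e \<Rightarrow> 'e \<Rightarrow> real" where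
  "fundamental_tensor N Y U V =
     1 / 2 * deriv (\<lambda>s. deriv (\<lambda>t. (N (Y + s *\<^sub>R U + t *\<^sub>R V))\<^sup>2) 0) 0"

text \<open>Connection coefficients \<open>\<Gamma>\<close> at \<open>(x, y)\<close> of the Chern connection of the coordinate Finsler
  metric \<open>L\<close>. It is the unique linear connection on the pulled-back tangent bundle that is
  torsion-free (no \<open>dy\<close>-part, and \<open>\<Gamma>\<close> symmetric) and almost compatible with the fundamental
  tensor: \<open>\<delta>\<^sub>u g(v, w) = g(\<Gamma> u v, w) + g(v, \<Gamma> u w)\<close>, where the horizontal derivative \<open>\<delta>\<^sub>u\<close> is the
  \<open>x\<close>-derivative along \<open>u\<close> minus the \<open>y\<close>-derivative along \<open>N(u) = \<Gamma> u y\<close> (the nonlinear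
  connection); the \<open>y\<close>-term is the usual Cartan tensor term.\<close>
definition chern_symbol ::
  "('e::euclidean_space \<Rightarrow> 'e \<Rightarrow> real) \<Rightarrow> 'e \<Rightarrow> 'e \<Rightarrow> 'e \<Rightarrow> 'e \<Rightarrow> 'e" where
  "chern_symbol L x y =
     (THE \<Gamma>. bilinear \<Gamma> \<and> (\<forall>u v. \<Gamma> u v = \<Gamma> v u) \<and>
        (\<forall>u v w.
           frechet_derivative (\<lambda>z. fundamental_tensor (L z) y v w) (at x) u
           - frechet_derivative (\<lambda>\<eta>. fundamental_tensor (L x) \<eta> v w) (at y) (\<Gamma> u y)
           = fundamental_tensor (L x) y (\<Gamma> u v) w + fundamental_tensor (L x) y v (\<Gamma> u w)))"

text \<open>Chern covariant derivative, in the direction of the horizontal lift of \<open>U\<close>, of a section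
  \<open>\<xi>\<close> of the pulled-back tangent bundle; \<open>(x, y)\<close> is the base point with the reference vector.\<close>
definition chern_deriv ::
  "('e::euclidean_space \<Rightarrow> 'e \<Rightarrow> real) \<Rightarrow> ('e \<Rightarrow> 'e) \<Rightarrow> ('e \<Rightarrow> 'e \<Rightarrow> 'e) \<Rightarrow> 'e \<Rightarrow> 'e \<Rightarrow> 'e" where
  "chern_deriv L U \<xi> x y =
     frechet_derivative (\<lambda>z. \<xi> z y) (at x) (U x)
     - frechet_derivative (\<xi> x) (at y) (chern_symbol L x y (U x) y)
     + chern_symbol L x y (U x) (\<xi> x y)"

text \<open>\<open>R(U, V)W = \<nabla>\<^sub>U \<nabla>\<^sub>V W - \<nabla>\<^sub>V \<nabla>\<^sub>U W - \<nabla>\<^bsub>[U, V]\<^esub> W\<close> for vector fields \<open>U, V, W\<close> on the base. The vertical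
  part of the bracket of the horizontal lifts of \<open>U\<close> and \<open>V\<close> does not contribute, as the Chern
  connection has no \<open>dy\<close>-part and \<open>W\<close> does not depend on \<open>y\<close>. The value is tensorial in \<open>U, V, W\<close>.\<close>
definition chern_curvature ::
  "('e::euclidean_space \<Rightarrow> 'e \<Rightarrow> real) \<Rightarrow> ('e \<Rightarrow> 'e) \<Rightarrow> ('e \<Rightarrow> 'e) \<Rightarrow> ('e \<Rightarrow> 'e) \<Rightarrow>
   'e \<Rightarrow> 'e \<Rightarrow> 'e" where
  "chern_curvature L U V W x y =
     chern_deriv L U (chern_deriv L V (\<lambda>z _. W z)) x y
     - chern_deriv L V (chern_deriv L U (\<lambda>z _. W z)) x y
     - chern_deriv L (coord_bracket U V) (\<lambda>z _. W z) x y"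

text \<open>The vector \<open>R(U, Y)Y\<close> at \<open>p\<close> with reference vector \<open>Y\<close>. By tensoriality, \<open>U\<close> and \<open>Y\<close> may be
  extended to vector fields near \<open>p\<close> with constant coordinates.\<close>
definition flag_operator ::
  "('m, 'e::euclidean_space) chart set \<Rightarrow> ('m \<Rightarrow> 'e \<Rightarrow> real) \<Rightarrow> 'm \<Rightarrow> 'e \<Rightarrow> 'e \<Rightarrow> 'e" where
  "flag_operator A F p Y U =
     (let c = chart_at A p
      in chern_curvature (finsler_coord A c F) (\<lambda>_. U) (\<lambda>_. Y) (\<lambda>_. Y) (snd c p) Y)"

definition is_flag :: "'e::euclidean_space set \<Rightarrow> 'e \<Rightarrow> bool" where
  "is_flag P Y \<longleftrightarrow> subspace P \<and> dim P = 2 \<and> Y \<in> P \<and> Y \<noteq> 0"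

text \<open>\<open>K(P, Y)\<close> at \<open>p\<close>: the common value of the quotient for all \<open>U\<close> with \<open>P = span {U, Y}\<close>.\<close>
definition flag_curvature ::
  "('m, 'e::euclidean_space) chart set \<Rightarrow> ('m \<Rightarrow> 'e \<Rightarrow> real) \<Rightarrow> 'm \<Rightarrow> 'e set \<Rightarrow> 'e \<Rightarrow> real" where
  "flag_curvature A F p P Y =
     (THE k. \<forall>U. P = span {U, Y} \<longrightarrow>
        k = fundamental_tensor (F p) Y (flag_operator A F p Y U) U /
            (fundamental_tensor (F p) Y Y Y * fundamental_tensor (F p) Y U U
             - (fundamental_tensor (F p) Y Y U)\<^sup>2))"

definition matsumoto_metric ::
  "('m \<Rightarrow> 'e \<Rightarrow> 'e \<Rightarrow> real) \<Rightarrow> ('m \<Rightarrow> 'e) \<Rightarrow> 'm \<Rightarrow> 'e \<Rightarrow> real" where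
  "matsumoto_metric g X p y =
     (let \<alpha> = sqrt (g p y y); \<beta> = g p (X p) y in \<alpha>\<^sup>2 / (\<alpha> - \<beta>))"

end

theory Submission
  imports Defs
begin

text \<open>
  Everything is transported to the preferred chart at the identity by means of the left invariant
  frame \<open>E\<close>. Differentiating associativity gives \<open>[E a, E b] = E [a, b]\<close>, and comparing the left and
  the right invariant frame at the identity, both of which are isometric, gives the skewness of
  \<open>ad\<close>. Hence \<open>\<nabla>\<^bsub>E a\<^esub> (E b) = E [a, b] / 2\<close> for the Levi-Civita connection, and a parallel left invariant
  field is central. Then the fundamental tensor of the Matsumoto metric is \<open>ad\<close>-invariant, so the
  same symbols solve the Chern equations, whose solution is unique. It follows that
  \<open>R(U, Y) Y = - [[U, Y], Y] / 4\<close>, a vector orthogonal to \<open>Y\<close> and \<open>X\<close>, and it remains to evaluate the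
  fundamental tensor explicitly.
\<close>

section \<open>Derivatives\<close>

text \<open>Both connections and the flag curvature are given by definite descriptions, and the
  curvature differentiates the Chern symbol. The symbol therefore has to be identified at all points
  of an open chart domain and for all nonzero reference vectors, not just at the identity. A chart
  domain is not closed under multiplication, so associativity and the invariance of the metric are
  carried over to a local group law defined on an open set of pairs.

  In the left invariant frame the Matsumoto metric is one fixed Minkowski norm, so it depends on the
  point only through the inverse frame. The resulting symbol does not depend on the reference
  vector: the metric is of Berwald type, and the fibre derivatives vanish in the curvature.

  The bound 1/2 on the length of \<open>X\<close> makes the fundamental tensor positive definite,
  and this nondegeneracy is what the uniqueness of the Chern symbol rests on. The 4 and the 8 in the
  final denominator come from the factor 1/4 of the curvature; the 8 contains a further factor 2
  from the Gram determinant of the flag.\<close>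

lemma smooth_on_deriv:
  assumes "smooth_on f S"
  shows "smooth_on (\<lambda>x. frechet_derivative f (at x) v) S"
proof -
  have "k_smooth_on (Suc k) f S" for k using assms by (simp only: smooth_on_def)
  then show ?thesis by (simp add: smooth_on_def)
qed

lemma smooth_on_differentiable:
  assumes "smooth_on f S" "x \<in> S"
  shows "f differentiable (at x)"
proof -
  have "k_smooth_on (Suc 0) f S" using assms by (simp only: smooth_on_def)
  then show ?thesis using assms(2) by simp
qed

lemma smooth_on_continuous:
  assumes "smooth_on f S"
  shows "continuous_on S f"
proof -
  have "k_smooth_on 0 f S" using assms by (simp only: smooth_on_def)
  then show ?thesis by simp
qed

lemma differentiable_derivD:
  "f differentiable (at x) \<Longrightarrow> (f has_derivative frechet_derivative f (at x)) (at x)"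
  by (simp add: frechet_derivative_works)

lemmas smooth_on_has_derivative = differentiable_derivD [OF smooth_on_differentiable]

lemma has_derivative_frechet_eq:
  "(f has_derivative f') (at x) \<Longrightarrow> frechet_derivative f (at x) = f'"
  using frechet_derivative_at by metis

lemma has_derivative_transform_open:
  assumes "(f has_derivative f') (at x)" "open S" "x \<in> S" "\<And>y. y \<in> S \<Longrightarrow> f y = g y"
  shows "(g has_derivative f') (at x)"
  using has_derivative_transform_within_open[OF assms(1-3)] assms(4) by auto

lemma frechet_derivative_cong_open:
  assumes "open S" "x \<in> S" "\<And>y. y \<in> S \<Longrightarrow> f y = g y"
  shows "frechet_derivative f (at x) = frechet_derivative g (at x)"
proof -
  have "(f has_derivative f') (at x) = (g has_derivative f') (at x)" for f'
    using has_derivative_transform_open[OF _ assms(1,2)] assms(3) by metis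
  then show ?thesis unfolding frechet_derivative_def by simp
qed

lemma linear_expand_Basis:
  fixes f :: "'a::euclidean_space \<Rightarrow> 'b::real_vector"
  assumes "linear f"
  shows "f v = (\<Sum>i\<in>Basis. (v \<bullet> i) *\<^sub>R f i)"
proof -
  have "f v = f (\<Sum>i\<in>Basis. (v \<bullet> i) *\<^sub>R i)" by (simp add: euclidean_representation)
  also have "\<dots> = (\<Sum>i\<in>Basis. (v \<bullet> i) *\<^sub>R f i)"
    by (simp add: linear_sum[OF assms] linear_scale[OF assms])
  finally show ?thesis .
qed

text \<open>Product rule for a family of linear maps of which only the values \<open>f y v\<close>
  at a fixed \<open>v\<close> are known to be differentiable. Expanding the argument in the basis
  reduces it to a finite sum of products.\<close>

lemma has_derivative_linear_apply:
  fixes f :: "'a::real_normed_vector \<Rightarrow> 'b::euclidean_space \<Rightarrow> 'c::real_normed_vector"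
  assumes f: "\<And>v. ((\<lambda>y. f y v) has_derivative f' v) (at x)"
    and g: "(g has_derivative g') (at x)"
    and S: "open S" "x \<in> S" "\<And>y. y \<in> S \<Longrightarrow> linear (f y)"
  shows "((\<lambda>y. f y (g y)) has_derivative (\<lambda>h. f' (g x) h + f x (g' h))) (at x)"
proof -
  have 1: "((\<lambda>y. \<Sum>i\<in>Basis. (w \<bullet> i) *\<^sub>R f y i) has_derivative
      (\<lambda>h. \<Sum>i\<in>Basis. (w \<bullet> i) *\<^sub>R f' i h)) (at x)" for w
    by (intro derivative_intros f)
  have 2: "f' w h = (\<Sum>i\<in>Basis. (w \<bullet> i) *\<^sub>R f' i h)" for w h
  proof -
    have "((\<lambda>y. f y w) has_derivative (\<lambda>h. \<Sum>i\<in>Basis. (w \<bullet> i) *\<^sub>R f' i h)) (at x)"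
      by (rule has_derivative_transform_open[OF 1 S(1,2)])
        (rule linear_expand_Basis[OF S(3), symmetric])
    from fun_cong[OF has_derivative_unique[OF f this]] show ?thesis .
  qed
  have 3: "((\<lambda>y. \<Sum>i\<in>Basis. (g y \<bullet> i) *\<^sub>R f y i) has_derivative
      (\<lambda>h. \<Sum>i\<in>Basis. (g x \<bullet> i) *\<^sub>R f' i h + (g' h \<bullet> i) *\<^sub>R f x i)) (at x)"
    by (intro derivative_intros f g has_derivative_inner_left)
  have "((\<lambda>y. f y (g y)) has_derivative
      (\<lambda>h. \<Sum>i\<in>Basis. (g x \<bullet> i) *\<^sub>R f' i h + (g' h \<bullet> i) *\<^sub>R f x i)) (at x)"
    by (rule has_derivative_transform_open[OF 3 S(1,2)])
      (rule linear_expand_Basis[OF S(3), symmetric])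
  moreover have "(\<lambda>h. \<Sum>i\<in>Basis. (g x \<bullet> i) *\<^sub>R f' i h + (g' h \<bullet> i) *\<^sub>R f x i) =
      (\<lambda>h. f' (g x) h + f x (g' h))"
    by (simp only: sum.distrib 2[of "g x", symmetric] linear_expand_Basis[OF S(3)[OF S(2)], symmetric])
  ultimately show ?thesis by simp
qed

text \<open>The mean value theorem is applied twice: along \<open>u\<close> to the increment of
  \<open>f\<close> in the direction \<open>v\<close>, and then along \<open>v\<close> to the
  derivative of \<open>f\<close> in the direction \<open>u\<close>.\<close>

lemma second_difference_mvt:
  fixes f :: "'a::real_normed_vector \<Rightarrow> real"
  assumes f: "\<And>z. z \<in> S \<Longrightarrow> (f has_derivative f' z) (at z)"
    and f': "\<And>z. z \<in> S \<Longrightarrow> ((\<lambda>z. f' z u) has_derivative f'' z) (at z)"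
    and h: "h > 0" and S: "\<And>s t. 0 \<le> s \<Longrightarrow> s \<le> h \<Longrightarrow> 0 \<le> t \<Longrightarrow> t \<le> h \<Longrightarrow> x + s *\<^sub>R u + t *\<^sub>R v \<in> S"
  shows "\<exists>s t. 0 < s \<and> s < h \<and> 0 < t \<and> t < h \<and>
    f (x + h *\<^sub>R u + h *\<^sub>R v) - f (x + h *\<^sub>R u) - f (x + h *\<^sub>R v) + f x =
    h * h * f'' (x + s *\<^sub>R u + t *\<^sub>R v) v"
proof -
  define p where "p s = f (x + s *\<^sub>R u + h *\<^sub>R v) - f (x + s *\<^sub>R u)" for s
  have D: "((\<lambda>s. f (x + s *\<^sub>R u + t *\<^sub>R v)) has_real_derivative f' (x + s *\<^sub>R u + t *\<^sub>R v) u) (at s)"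
    if "0 \<le> s" "s \<le> h" "0 \<le> t" "t \<le> h" for s t
  proof -
    have "linear (f' (x + s *\<^sub>R u + t *\<^sub>R v))" using f[OF S[OF that]] has_derivative_linear by blast
    moreover have "((\<lambda>s. f (x + s *\<^sub>R u + t *\<^sub>R v)) has_derivative
        (\<lambda>k. f' (x + s *\<^sub>R u + t *\<^sub>R v) (k *\<^sub>R u))) (at s)"
      by (rule has_derivative_compose[where f="\<lambda>s. x + s *\<^sub>R u + t *\<^sub>R v", OF _ f[OF S[OF that]]]) (auto intro!: derivative_eq_intros)
    ultimately show ?thesis
      by (simp add: has_field_derivative_def linear_scale mult.commute[of _ "f' _ _"] cong: if_cong)
  qed
  have D0: "((\<lambda>s. f (x + s *\<^sub>R u)) has_real_derivative f' (x + s *\<^sub>R u) u) (at s)"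
    if "0 \<le> s" "s \<le> h" for s
    using D[OF that, of 0] h by simp
  have "\<exists>s. 0 < s \<and> s < h \<and> p h - p 0 = (h - 0) * (f' (x + s *\<^sub>R u + h *\<^sub>R v) u - f' (x + s *\<^sub>R u) u)"
    unfolding p_def using h by (intro MVT2 DERIV_diff D D0) auto
  then obtain s where s: "0 < s" "s < h"
    "p h - p 0 = h * (f' (x + s *\<^sub>R u + h *\<^sub>R v) u - f' (x + s *\<^sub>R u) u)" by auto
  have E: "((\<lambda>t. f' (x + s *\<^sub>R u + t *\<^sub>R v) u) has_real_derivative f'' (x + s *\<^sub>R u + t *\<^sub>R v) v) (at t)"
    if "0 \<le> t" "t \<le> h" for t
  proof -
    have in_S: "x + s *\<^sub>R u + t *\<^sub>R v \<in> S" using S s that by simp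
    have "linear (f'' (x + s *\<^sub>R u + t *\<^sub>R v))" using f'[OF in_S] has_derivative_linear by blast
    moreover have "((\<lambda>t. f' (x + s *\<^sub>R u + t *\<^sub>R v) u) has_derivative
        (\<lambda>k. f'' (x + s *\<^sub>R u + t *\<^sub>R v) (k *\<^sub>R v))) (at t)"
      by (rule has_derivative_compose[where f="\<lambda>t. x + s *\<^sub>R u + t *\<^sub>R v", OF _ f'[OF in_S]]) (auto intro!: derivative_eq_intros)
    ultimately show ?thesis
      by (simp add: has_field_derivative_def linear_scale mult.commute[of _ "f'' _ _"] cong: if_cong)
  qed
  have "\<exists>t. 0 < t \<and> t < h \<and> f' (x + s *\<^sub>R u + h *\<^sub>R v) u - f' (x + s *\<^sub>R u + 0 *\<^sub>R v) u =
      (h - 0) * f'' (x + s *\<^sub>R u + t *\<^sub>R v) v"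
    by (rule MVT2[OF h]) (rule E)
  then obtain t where "0 < t" "t < h"
    "f' (x + s *\<^sub>R u + h *\<^sub>R v) u - f' (x + s *\<^sub>R u) u = h * f'' (x + s *\<^sub>R u + t *\<^sub>R v) v"
    by auto
  with s show ?thesis
    by (intro exI[of _ s] exI[of _ t]) (simp add: p_def algebra_simps)
qed

text \<open>Schwarz's theorem. The same second difference over a small parallelogram equals
  \<open>h * h\<close> times either mixed derivative at nearby points, so by continuity the two
  cannot differ at \<open>x\<close>.\<close>

lemma symmetric_second_derivative_real:
  fixes f :: "'a::real_normed_vector \<Rightarrow> real"
  assumes S: "open S" "x \<in> S"
    and f: "\<And>z. z \<in> S \<Longrightarrow> (f has_derivative f' z) (at z)"
    and fu: "\<And>z. z \<in> S \<Longrightarrow> ((\<lambda>z. f' z u) has_derivative fu' z) (at z)"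
    and fv: "\<And>z. z \<in> S \<Longrightarrow> ((\<lambda>z. f' z v) has_derivative fv' z) (at z)"
    and cu: "continuous_on S (\<lambda>z. fu' z v)" and cv: "continuous_on S (\<lambda>z. fv' z u)"
  shows "fu' x v = fv' x u"
proof (rule ccontr)
  assume ne: "fu' x v \<noteq> fv' x u"
  define e where "e = \<bar>fu' x v - fv' x u\<bar> / 2"
  have e: "e > 0" using ne by (simp add: e_def)
  have "isCont (\<lambda>z. fu' z v) x" "isCont (\<lambda>z. fv' z u) x"
    using cu cv S by (simp_all add: continuous_on_eq_continuous_at)
  then obtain d1 d2 where d: "d1 > 0" "d2 > 0"
    "\<And>z. dist z x < d1 \<Longrightarrow> dist (fu' z v) (fu' x v) < e"
    "\<And>z. dist z x < d2 \<Longrightarrow> dist (fv' z u) (fv' x u) < e"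
    using e unfolding continuous_at_eps_delta by metis
  obtain d3 where d3: "d3 > 0" "ball x d3 \<subseteq> S" using S openE by blast
  define d where "d = min d1 (min d2 d3)"
  have dpos: "d > 0" using d d3 by (simp add: d_def)
  \<comment> \<open>The summand 1 keeps \<open>n\<close> positive. With \<open>h\<close> as below,
    the parallelogram with sides \<open>h\<close> times \<open>u\<close> and \<open>h\<close> times
    \<open>v\<close> stays within distance \<open>d / 2\<close> of \<open>x\<close>.\<close>
  define n where "n = norm u + norm v + 1"
  define h where "h = d / n / 2"
  have nn: "n > 0" unfolding n_def by (smt (verit) norm_ge_zero)
  have h: "h > 0" using dpos nn by (simp add: h_def)
  have near: "dist (x + s *\<^sub>R u + t *\<^sub>R v) x < d" if "0 \<le> s" "s \<le> h" "0 \<le> t" "t \<le> h" for s t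
  proof -
    have "dist (x + s *\<^sub>R u + t *\<^sub>R v) x = norm (s *\<^sub>R u + t *\<^sub>R v)" by (simp add: dist_norm)
    also have "\<dots> \<le> s * norm u + t * norm v" using norm_triangle_ineq[of "s *\<^sub>R u" "t *\<^sub>R v"] that by simp
    also have "\<dots> \<le> h * norm u + h * norm v" using that by (intro add_mono mult_right_mono) auto
    also have "\<dots> \<le> h * n" using h by (simp add: n_def algebra_simps)
    also have "\<dots> = d / 2" using nn by (simp add: h_def)
    finally show ?thesis using dpos by simp
  qed
  have near': "dist (x + s *\<^sub>R v + t *\<^sub>R u) x < d" if "0 \<le> s" "s \<le> h" "0 \<le> t" "t \<le> h" for s t
    using near[OF that(3,4,1,2)] by (simp add: algebra_simps)
  have in_S: "z \<in> S" if "dist z x < d" for z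
    using that d3 by (auto simp: d_def dist_commute subset_iff)
  obtain s t where st: "0 < s" "s < h" "0 < t" "t < h"
    "f (x + h *\<^sub>R u + h *\<^sub>R v) - f (x + h *\<^sub>R u) - f (x + h *\<^sub>R v) + f x =
      h * h * fu' (x + s *\<^sub>R u + t *\<^sub>R v) v"
    using second_difference_mvt[of S f f' u fu' h x v] f fu h in_S near by blast
  obtain s' t' where st': "0 < s'" "s' < h" "0 < t'" "t' < h"
    "f (x + h *\<^sub>R v + h *\<^sub>R u) - f (x + h *\<^sub>R v) - f (x + h *\<^sub>R u) + f x =
      h * h * fv' (x + s' *\<^sub>R v + t' *\<^sub>R u) u"
    using second_difference_mvt[of S f f' v fv' h x u] f fv h in_S near' by blast
  \<comment> \<open>The second difference is symmetric in \<open>u\<close> and \<open>v\<close>, so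
    both applications of the mean value theorem evaluate the same number.\<close>
  have "f (x + h *\<^sub>R v + h *\<^sub>R u) = f (x + h *\<^sub>R u + h *\<^sub>R v)" by (simp add: algebra_simps)
  then have "h * h * fu' (x + s *\<^sub>R u + t *\<^sub>R v) v = h * h * fv' (x + s' *\<^sub>R v + t' *\<^sub>R u) u"
    using st(5) st'(5) by linarith
  then have eq: "fu' (x + s *\<^sub>R u + t *\<^sub>R v) v = fv' (x + s' *\<^sub>R v + t' *\<^sub>R u) u"
    using h by (metis less_numeral_extra(3) mult_cancel_left mult_eq_0_iff)
  have "dist (fu' (x + s *\<^sub>R u + t *\<^sub>R v) v) (fu' x v) < e"
    by (rule d(3)) (use near[of s t] st in \<open>simp add: d_def\<close>)
  moreover have "dist (fv' (x + s' *\<^sub>R v + t' *\<^sub>R u) u) (fv' x u) < e"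
    by (rule d(4)) (use near'[of s' t'] st' in \<open>simp add: d_def\<close>)
  ultimately have "\<bar>fu' x v - fv' x u\<bar> < 2 * e"
    using eq by (simp add: dist_real_def)
  then show False by (simp add: e_def)
qed

text \<open>Schwarz's theorem in each component. Applied to the group multiplication and to the
  frame, it removes the second derivatives from the brackets and from the curvature.\<close>

lemma smooth_on_symmetric_second_derivative:
  fixes f :: "'a::euclidean_space \<Rightarrow> 'b::euclidean_space"
  assumes f: "smooth_on f S" and S: "open S" "x \<in> S"
  shows "frechet_derivative (\<lambda>z. frechet_derivative f (at z) u) (at x) v =
    frechet_derivative (\<lambda>z. frechet_derivative f (at z) v) (at x) u"
proof (rule euclidean_eqI)
  fix b :: 'b assume "b \<in> Basis"
  have c: "continuous_on S (\<lambda>z. frechet_derivative (\<lambda>z. frechet_derivative f (at z) u) (at z) v \<bullet> b)" for u v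
    by (intro continuous_intros smooth_on_continuous smooth_on_deriv f)
  show "frechet_derivative (\<lambda>z. frechet_derivative f (at z) u) (at x) v \<bullet> b =
    frechet_derivative (\<lambda>z. frechet_derivative f (at z) v) (at x) u \<bullet> b"
    by (rule symmetric_second_derivative_real[OF S,
        where f="\<lambda>z. f z \<bullet> b" and f'="\<lambda>z h. frechet_derivative f (at z) h \<bullet> b"
          and fu'="\<lambda>z h. frechet_derivative (\<lambda>z. frechet_derivative f (at z) u) (at z) h \<bullet> b"
          and fv'="\<lambda>z h. frechet_derivative (\<lambda>z. frechet_derivative f (at z) v) (at z) h \<bullet> b"])
      (rule c | rule has_derivative_inner_left, rule smooth_on_has_derivative[OF f], assumption
        | rule has_derivative_inner_left, rule smooth_on_has_derivative[OF smooth_on_deriv[OF f]], assumption)+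
qed


section \<open>The Minkowski norm of a Matsumoto metric\<close>

locale inner_form =
  fixes ip :: "'e::euclidean_space \<Rightarrow> 'e \<Rightarrow> real"
  assumes ip_bilinear: "bilinear ip"
    and ip_sym: "ip u v = ip v u"
    and ip_pos: "u \<noteq> 0 \<Longrightarrow> ip u u > 0"
begin

lemmas ip_simps =
  bilinear_ladd[OF ip_bilinear] bilinear_radd[OF ip_bilinear]
  bilinear_lsub[OF ip_bilinear] bilinear_rsub[OF ip_bilinear]
  bilinear_lmul[OF ip_bilinear] bilinear_rmul[OF ip_bilinear]
  bilinear_lneg[OF ip_bilinear] bilinear_rneg[OF ip_bilinear]
  bilinear_lzero[OF ip_bilinear] bilinear_rzero[OF ip_bilinear]

lemma ip_bounded_bilinear: "bounded_bilinear ip"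
  using ip_bilinear bilinear_conv_bounded_bilinear by blast

lemma ip_nonneg: "0 \<le> ip u u"
  using ip_pos[of u] by (cases "u = 0") (auto simp: ip_simps)

lemma ip_nondegenerate:
  assumes "\<And>w. ip u w = 0"
  shows "u = 0"
  using ip_pos[of u] assms[of u] by force

lemma ip_Cauchy_Schwarz: "(ip u v)\<^sup>2 \<le> ip u u * ip v v"
proof (cases "v = 0")
  case False
  \<comment> \<open>The vector is \<open>ip v v\<close> times the component of \<open>u\<close>
    orthogonal to \<open>v\<close>.\<close>
  have "0 \<le> ip (ip v v *\<^sub>R u - ip u v *\<^sub>R v) (ip v v *\<^sub>R u - ip u v *\<^sub>R v)"
    by (rule ip_nonneg)
  also have "\<dots> = ip v v * (ip u u * ip v v - (ip u v)\<^sup>2)"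
    by (simp add: ip_simps ip_sym[of v u] power2_eq_square algebra_simps)
  finally show ?thesis using ip_pos[OF False] by (simp add: zero_le_mult_iff)
qed (simp add: ip_simps)

end

locale matsumoto_norm = inner_form ip for ip :: "'e::euclidean_space \<Rightarrow> 'e \<Rightarrow> real" +
  fixes X :: 'e
  assumes X_small: "sqrt (ip X X) < 1 / 2"
begin

definition rad :: "'e \<Rightarrow> real" where "rad a = sqrt (ip a a)"

definition den :: "'e \<Rightarrow> real" where "den a = rad a - ip X a"

text \<open>With the reciprocal of \<alpha> - \<beta> as a function of its own, the derivatives
  below are polynomials in \<open>rad\<close>, \<open>rden\<close> and inner products, and
  identities between them reduce to ring normalisation.\<close>

definition rden :: "'e \<Rightarrow> real" where "rden a = inverse (den a)"

definition norm_fun :: "'e \<Rightarrow> real" where "norm_fun a = (rad a)\<^sup>2 / den a"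

text \<open>Half the derivative of \<open>(norm_fun)\<^sup>2\<close>, and half its Hessian.\<close>

definition half_deriv :: "'e \<Rightarrow> 'e \<Rightarrow> real" where
  "half_deriv a v = 2 * rad a ^ 2 * rden a ^ 2 * ip a v
    - rden a ^ 3 * rad a ^ 2 * (rad a * ip a v - rad a ^ 2 * ip X v)"

definition tensor :: "'e \<Rightarrow> 'e \<Rightarrow> 'e \<Rightarrow> real" where
  "tensor a v w = (2 * rad a ^ 2 * rden a ^ 2 - rad a ^ 3 * rden a ^ 3) * ip v w
    + (4 * rden a ^ 2 + rad a * rden a ^ 3) * ip a v * ip a w
    - 4 * rden a ^ 3 * (ip a v * (rad a * ip a w - rad a ^ 2 * ip X w)
                        + ip a w * (rad a * ip a v - rad a ^ 2 * ip X v))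
    + 3 * rden a ^ 4 * (rad a * ip a v - rad a ^ 2 * ip X v) * (rad a * ip a w - rad a ^ 2 * ip X w)"

lemma rad_pos: "a \<noteq> 0 \<Longrightarrow> rad a > 0"
  using ip_pos by (simp add: rad_def)

lemma rad_sq: "rad a ^ 2 = ip a a"
  using ip_nonneg by (simp add: rad_def)

text \<open>The bound on the length of \<open>X\<close> enters here through Cauchy-Schwarz. The
  inequality says that \<open>2 * den a - rad a\<close> is positive, the factor that decides
  definiteness in \<open>tensor_self_eq\<close>; it also gives \<open>den a > 0\<close>.\<close>

lemma two_ip_less_rad:
  assumes "a \<noteq> 0"
  shows "2 * ip X a < rad a"
proof -
  have "ip X a \<le> sqrt ((ip X a)\<^sup>2)" by simp
  also have "\<dots> \<le> sqrt (ip X X * ip a a)" using ip_Cauchy_Schwarz real_sqrt_le_mono by blast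
  also have "\<dots> = sqrt (ip X X) * rad a" by (simp add: rad_def real_sqrt_mult)
  also have "\<dots> < 1 / 2 * rad a" using X_small rad_pos[OF assms] by (rule mult_strict_right_mono)
  finally show ?thesis by simp
qed

lemma den_pos: "a \<noteq> 0 \<Longrightarrow> den a > 0"
  using two_ip_less_rad[of a] rad_pos[of a] by (simp add: den_def)

lemma has_derivative_ip_left: "((\<lambda>a. ip a v) has_derivative (\<lambda>z. ip z v)) (at a)"
  using bounded_bilinear.bounded_linear_left[OF ip_bounded_bilinear] bounded_linear_imp_has_derivative by blast

lemma has_derivative_ip_right: "((\<lambda>a. ip v a) has_derivative (\<lambda>z. ip v z)) (at a)"
  using has_derivative_ip_left[of v a] by (simp add: ip_sym)

lemma has_derivative_rad:
  assumes "a \<noteq> 0"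
  shows "(rad has_derivative (\<lambda>z. ip a z / rad a)) (at a)"
proof -
  have "((\<lambda>a. ip a a) has_derivative (\<lambda>z. ip a z + ip z a)) (at a)"
    by (rule bounded_bilinear.FDERIV[OF ip_bounded_bilinear]) (auto intro: has_derivative_ident)
  then have "((\<lambda>a. sqrt (ip a a)) has_derivative (\<lambda>z. (ip a z + ip z a) * (inverse (sqrt (ip a a)) / 2))) (at a)"
    by (rule has_derivative_real_sqrt[where g="\<lambda>a. ip a a" and x=a, OF ip_pos[OF assms]])
  moreover have "(ip a z + ip z a) * (inverse (sqrt (ip a a)) / 2) = ip a z / rad a" for z
    unfolding ip_sym[of z a] rad_def by (simp add: field_simps)
  ultimately show ?thesis unfolding rad_def[abs_def] by (simp only: rad_def)
qed

lemma has_derivative_rden: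
  assumes "a \<noteq> 0"
  shows "(rden has_derivative (\<lambda>z. - (rden a ^ 2 * (ip a z / rad a - ip X z)))) (at a)"
proof -
  have "(den has_derivative (\<lambda>z. ip a z / rad a - ip X z)) (at a)"
    unfolding den_def[abs_def]
    by (rule has_derivative_diff[OF has_derivative_rad[OF assms] has_derivative_ip_right])
  then have "((\<lambda>a. inverse (den a)) has_derivative
      (\<lambda>z. - (inverse (den a) * (ip a z / rad a - ip X z) * inverse (den a)))) (at a)"
    using den_pos[OF assms] by (intro Deriv.has_derivative_inverse) auto
  then show ?thesis
    unfolding rden_def[abs_def]
    by (rule has_derivative_eq_rhs) (simp add: fun_eq_iff power2_eq_square)
qed

lemma has_derivative_norm_fun_sq:
  assumes "a \<noteq> 0"
  shows "((\<lambda>a. (norm_fun a)\<^sup>2) has_derivative (\<lambda>z. 2 * half_deriv a z)) (at a)"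
proof -
  have eq: "(\<lambda>a. (norm_fun a)\<^sup>2) = (\<lambda>a. rad a ^ 4 * rden a ^ 2)"
    by (simp add: fun_eq_iff norm_fun_def rden_def divide_inverse power_mult_distrib flip: power_mult)
  have "((\<lambda>a. rad a ^ 4 * rden a ^ 2) has_derivative
     (\<lambda>z. rad a ^ 4 * (of_nat 2 * (- (rden a ^ 2 * (ip a z / rad a - ip X z))) * rden a ^ (2 - 1)) +
          of_nat 4 * (ip a z / rad a) * rad a ^ (4 - 1) * rden a ^ 2)) (at a)"
    by (intro derivative_intros has_derivative_rad has_derivative_rden assms)
  moreover have "rad a ^ 4 * (of_nat 2 * (- (rden a ^ 2 * (ip a z / rad a - ip X z))) * rden a ^ (2 - 1)) +
          of_nat 4 * (ip a z / rad a) * rad a ^ (4 - 1) * rden a ^ 2 = 2 * half_deriv a z" for z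
  proof -
    \<comment> \<open>Writing \<open>ip a z\<close> as \<open>rad a * rp\<close> removes the
      division by \<open>rad a\<close>, after which both sides are polynomials.\<close>
    define rp where "rp = ip a z / rad a"
    have rp: "ip a z = rad a * rp" using rad_pos[OF assms] by (simp add: rp_def)
    show ?thesis
      unfolding half_deriv_def rp_def[symmetric] rp
      by (simp add: algebra_simps power2_eq_square power3_eq_cube power4_eq_xxxx)
  qed
  ultimately show ?thesis unfolding eq by simp
qed

lemma has_derivative_half_deriv:
  assumes "a \<noteq> 0"
  shows "((\<lambda>a. half_deriv a v) has_derivative (\<lambda>z. tensor a v z)) (at a)"
proof -
  define r' where "r' z = ip a z / rad a" for z
  define k' where "k' z = - (rden a ^ 2 * (ip a z / rad a - ip X z))" for z
  have r: "(rad has_derivative r') (at a)" and k: "(rden has_derivative k') (at a)"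
    using has_derivative_rad[OF assms] has_derivative_rden[OF assms] by (simp_all add: r'_def[abs_def] k'_def[abs_def])
  show ?thesis
    unfolding half_deriv_def
    apply (rule has_derivative_eq_rhs)
     apply (rule derivative_eq_intros r k has_derivative_ip_left refl)+
    apply (rule ext)
    subgoal for z
    proof -
      have rp: "ip a z = rad a * r' z" "ip z v = ip v z" using rad_pos[OF assms] ip_sym by (auto simp: r'_def)
      have kp: "k' z = - (rden a ^ 2 * (r' z - ip X z))" by (simp add: k'_def r'_def)
      show ?thesis
        unfolding tensor_def kp rp
        by (simp add: algebra_simps power2_eq_square power3_eq_cube power4_eq_xxxx)
    qed
    done
qed

lemma tensor_sym: "tensor a v w = tensor a w v"
  by (simp add: tensor_def ip_sym[of v w] algebra_simps)

lemma tensor_bilinear: "bilinear (tensor a)"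
  unfolding bilinear_def by (auto intro!: linearI simp: tensor_def ip_simps algebra_simps)

text \<open>Completing the square. The form \<open>rad a * ip a v - rad a ^ 2 * ip X v\<close> is
  \<open>rad a ^ 2\<close> times the derivative of \<open>den\<close> along \<open>v\<close>. After
  multiplication by \<open>den a ^ 4\<close> it occurs with square coefficient 3 and cross
  coefficient \<open>- 8 * den a * ip a v\<close>, whence the shift by 4/3. The first summand is a
  multiple of the Gram determinant of \<open>a\<close> and \<open>v\<close>, and 2/3 is the
  coefficient then left for \<open>(den a * ip a v)\<^sup>2\<close>.\<close>

lemma tensor_self_eq:
  assumes "a \<noteq> 0"
  shows "den a ^ 4 * tensor a v v =
    den a * (2 * den a - rad a) * (rad a ^ 2 * ip v v - (ip a v)\<^sup>2)
    + 3 * (rad a * ip a v - rad a ^ 2 * ip X v - 4 / 3 * den a * ip a v)\<^sup>2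
    + 2 / 3 * (den a * ip a v)\<^sup>2"
proof -
  have k: "den a * rden a = 1" using den_pos[OF assms] by (simp add: rden_def)
  have k2: "den a ^ 4 * rden a ^ 2 = den a ^ 2" "den a ^ 4 * rden a ^ 3 = den a" "den a ^ 4 * rden a ^ 4 = 1"
    using den_pos[OF assms] by (auto simp: rden_def field_simps power2_eq_square power3_eq_cube power4_eq_xxxx)
  have "den a ^ 4 * tensor a v v = (2 * rad a ^ 2 * (den a ^ 4 * rden a ^ 2) - rad a ^ 3 * (den a ^ 4 * rden a ^ 3)) * ip v v
    + (4 * (den a ^ 4 * rden a ^ 2) + rad a * (den a ^ 4 * rden a ^ 3)) * ip a v * ip a v
    - 4 * (den a ^ 4 * rden a ^ 3) * (ip a v * (rad a * ip a v - rad a ^ 2 * ip X v)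
                        + ip a v * (rad a * ip a v - rad a ^ 2 * ip X v))
    + 3 * (den a ^ 4 * rden a ^ 4) * (rad a * ip a v - rad a ^ 2 * ip X v) * (rad a * ip a v - rad a ^ 2 * ip X v)"
    unfolding tensor_def by (simp only: algebra_simps)
  also have "\<dots> = den a * (2 * den a - rad a) * (rad a ^ 2 * ip v v - (ip a v)\<^sup>2)
    + 3 * (rad a * ip a v - rad a ^ 2 * ip X v - 4 / 3 * den a * ip a v)\<^sup>2
    + 2 / 3 * (den a * ip a v)\<^sup>2"
    unfolding k2 by (simp add: algebra_simps power2_eq_square power3_eq_cube power4_eq_xxxx)
  finally show ?thesis .
qed

text \<open>All three summands in \<open>tensor_self_eq\<close> are nonnegative. The Gram term is
  strictly positive when \<open>v\<close> is orthogonal to \<open>a\<close>, and the last square is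
  strictly positive otherwise.\<close>

lemma tensor_pos:
  assumes a: "a \<noteq> 0" and v: "v \<noteq> 0"
  shows "tensor a v v > 0"
proof -
  have cs: "rad a ^ 2 * ip v v - (ip a v)\<^sup>2 \<ge> 0" using ip_Cauchy_Schwarz[of a v] by (simp add: rad_sq)
  have d: "den a * (2 * den a - rad a) > 0"
    using den_pos[OF a] two_ip_less_rad[OF a] by (simp add: den_def)
  have "0 < den a * (2 * den a - rad a) * (rad a ^ 2 * ip v v - (ip a v)\<^sup>2) + 2 / 3 * (den a * ip a v)\<^sup>2"
  proof (cases "ip a v = 0")
    case True
    then show ?thesis using d rad_pos[OF a] ip_pos[OF v] by simp
  next
    case False
    then have "0 < 2 / 3 * (den a * ip a v)\<^sup>2" using den_pos[OF a] by simp
    moreover have "0 \<le> den a * (2 * den a - rad a) * (rad a ^ 2 * ip v v - (ip a v)\<^sup>2)"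
      using d cs by (intro mult_nonneg_nonneg[of "den a * (2 * den a - rad a)"]) auto
    ultimately show ?thesis by linarith
  qed
  also have "\<dots> \<le> den a ^ 4 * tensor a v v"
    unfolding tensor_self_eq[OF a] by simp
  finally show ?thesis using den_pos[OF a] by (simp add: zero_less_mult_iff)
qed

text \<open>Euler's relation: half the derivative of the squared norm is homogeneous of degree 1 in
  \<open>a\<close>, so its derivative in the direction \<open>a\<close> reproduces it.\<close>

lemma tensor_Euler:
  assumes "a \<noteq> 0"
  shows "tensor a a w = half_deriv a w"
proof -
  have d: "den a * rden a = 1" "ip X a = rad a - den a" using den_pos[OF assms] by (auto simp: rden_def den_def)
  define k q r where "k = rden a" and "q = den a" and "r = rad a"
  have A: "ip a a = r\<^sup>2" using rad_sq[of a] by (simp add: r_def)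
  have kq: "k * q = 1" using d(1) by (simp add: k_def q_def mult.commute)
  \<comment> \<open>The derivative of \<open>den\<close> along \<open>a\<close> is
    \<open>den a\<close> itself, by homogeneity; \<open>R\<close> is this value times
    \<open>r\<^sup>2\<close>.\<close>
  have R: "r * ip a a - r\<^sup>2 * ip X a = r\<^sup>2 * q"
    unfolding A d(2) r_def[symmetric] q_def[symmetric] by (simp add: algebra_simps power2_eq_square)
  have "tensor a a w = (2 * r ^ 2 * k ^ 2 - r ^ 3 * k ^ 3) * ip a w
    + (4 * k ^ 2 + r * k ^ 3) * r\<^sup>2 * ip a w
    - 4 * k ^ 2 * (k * r\<^sup>2 * (r * ip a w - r ^ 2 * ip X w) + ip a w * (r\<^sup>2 * (k * q)))
    + 3 * k ^ 3 * (r\<^sup>2 * (k * q)) * (r * ip a w - r ^ 2 * ip X w)"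
    unfolding tensor_def k_def[symmetric] r_def[symmetric] R unfolding A
    by (simp add: algebra_simps power2_eq_square power3_eq_cube power4_eq_xxxx)
  also have "\<dots> = half_deriv a w"
    unfolding half_deriv_def k_def[symmetric] r_def[symmetric] kq
    by (simp add: algebra_simps power2_eq_square power3_eq_cube power4_eq_xxxx)
  finally show ?thesis .
qed

text \<open>Only directions tangent to the level sets of \<open>rad\<close> and \<open>ip X\<close> are needed; there the radial
  coefficients of the tensor do not contribute.\<close>

lemma tensor_derivative:
  assumes a: "a \<noteq> 0"
  shows "(\<lambda>\<eta>. tensor \<eta> v w) differentiable (at a)" (is ?A)
    and "ip a z = 0 \<Longrightarrow> ip X z = 0 \<Longrightarrow> frechet_derivative (\<lambda>\<eta>. tensor \<eta> v w) (at a) z =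
      (4 * rden a ^ 2 + rad a * rden a ^ 3) * (ip z v * ip a w + ip a v * ip z w)
    - 4 * rden a ^ 3 * (ip z v * (rad a * ip a w - rad a ^ 2 * ip X w) + ip a v * (rad a * ip z w)
                        + ip z w * (rad a * ip a v - rad a ^ 2 * ip X v) + ip a w * (rad a * ip z v))
    + 3 * rden a ^ 4 * ((rad a * ip z v) * (rad a * ip a w - rad a ^ 2 * ip X w)
                       + (rad a * ip a v - rad a ^ 2 * ip X v) * (rad a * ip z w))"
proof -
  define r' where "r' z = ip a z / rad a" for z
  define k' where "k' z = - (rden a ^ 2 * (ip a z / rad a - ip X z))" for z
  have r: "(rad has_derivative r') (at a)" and k: "(rden has_derivative k') (at a)"
    using has_derivative_rad[OF assms] has_derivative_rden[OF assms] by (simp_all add: r'_def[abs_def] k'_def[abs_def])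
  have "\<exists>D. ((\<lambda>\<eta>. tensor \<eta> v w) has_derivative D) (at a) \<and> (ip a z = 0 \<longrightarrow> ip X z = 0 \<longrightarrow> D z =
      (4 * rden a ^ 2 + rad a * rden a ^ 3) * (ip z v * ip a w + ip a v * ip z w)
    - 4 * rden a ^ 3 * (ip z v * (rad a * ip a w - rad a ^ 2 * ip X w) + ip a v * (rad a * ip z w)
                        + ip z w * (rad a * ip a v - rad a ^ 2 * ip X v) + ip a w * (rad a * ip z v))
    + 3 * rden a ^ 4 * ((rad a * ip z v) * (rad a * ip a w - rad a ^ 2 * ip X w)
                       + (rad a * ip a v - rad a ^ 2 * ip X v) * (rad a * ip z w)))"
    unfolding tensor_def
    apply (rule exI, rule conjI)
     apply (rule derivative_eq_intros r k has_derivative_ip_left refl)+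
    apply (simp add: r'_def k'_def algebra_simps)
    done
  then obtain D where D: "((\<lambda>\<eta>. tensor \<eta> v w) has_derivative D) (at a)"
    "ip a z = 0 \<Longrightarrow> ip X z = 0 \<Longrightarrow> D z =
      (4 * rden a ^ 2 + rad a * rden a ^ 3) * (ip z v * ip a w + ip a v * ip z w)
    - 4 * rden a ^ 3 * (ip z v * (rad a * ip a w - rad a ^ 2 * ip X w) + ip a v * (rad a * ip z w)
                        + ip z w * (rad a * ip a v - rad a ^ 2 * ip X v) + ip a w * (rad a * ip z v))
    + 3 * rden a ^ 4 * ((rad a * ip z v) * (rad a * ip a w - rad a ^ 2 * ip X w)
                       + (rad a * ip a v - rad a ^ 2 * ip X v) * (rad a * ip z w))" by blast
  then show ?A by (auto simp: differentiable_def)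
  show "ip a z = 0 \<Longrightarrow> ip X z = 0 \<Longrightarrow> frechet_derivative (\<lambda>\<eta>. tensor \<eta> v w) (at a) z =
      (4 * rden a ^ 2 + rad a * rden a ^ 3) * (ip z v * ip a w + ip a v * ip z w)
    - 4 * rden a ^ 3 * (ip z v * (rad a * ip a w - rad a ^ 2 * ip X w) + ip a v * (rad a * ip z w)
                        + ip z w * (rad a * ip a v - rad a ^ 2 * ip X v) + ip a w * (rad a * ip z v))
    + 3 * rden a ^ 4 * ((rad a * ip z v) * (rad a * ip a w - rad a ^ 2 * ip X w)
                       + (rad a * ip a v - rad a ^ 2 * ip X v) * (rad a * ip z w))"
    using D has_derivative_frechet_eq by metis
qed

text \<open>A skew \<open>K\<close> with image orthogonal to \<open>X\<close> generates isometries
  of \<open>ip\<close> that fix \<open>X\<close>, hence preserve the norm. The equation is the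
  infinitesimal invariance of its Hessian, read off from the explicit formula because
  \<open>K a\<close> is orthogonal to both \<open>a\<close> and \<open>X\<close>.\<close>

lemma tensor_invariant:
  assumes a: "a \<noteq> 0"
    and skew: "\<And>u v. ip (K u) v + ip u (K v) = 0" and KX: "\<And>v. ip X (K v) = 0"
  shows "frechet_derivative (\<lambda>\<eta>. tensor \<eta> v w) (at a) (K a) + tensor a (K v) w + tensor a v (K w) = 0"
proof -
  have 0: "ip a (K a) = 0" using skew[of a a] by (simp add: ip_sym)
  have s: "ip a (K v) = - ip (K a) v" for v using skew[of a v] by simp
  have s': "ip (K v) w = - ip v (K w)" using skew[of v w] by simp
  show ?thesis
    unfolding tensor_derivative(2)[OF a 0 KX] unfolding tensor_def KX s s'
    by (simp add: algebra_simps)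
qed

text \<open>The Cartan tensor vanishes once one argument is the reference vector. Both sides of
  Euler's relation are differentiated: the product rule on the left yields one term more than the
  Hessian on the right, and this term must be zero.\<close>

lemma tensor_radial_derivative:
  assumes a: "a \<noteq> 0"
  shows "frechet_derivative (\<lambda>\<eta>. tensor \<eta> a w) (at a) z = 0"
proof -
  have "((\<lambda>\<eta>. tensor \<eta> \<eta> w) has_derivative
     (\<lambda>h. frechet_derivative (\<lambda>\<eta>. tensor \<eta> a w) (at a) h + tensor a h w)) (at a)"
    by (rule has_derivative_linear_apply[where f="\<lambda>\<eta> v. tensor \<eta> v w" and S=UNIV
          and g="\<lambda>\<eta>. \<eta>" and g'="\<lambda>h. h" and f'="\<lambda>v. frechet_derivative (\<lambda>\<eta>. tensor \<eta> v w) (at a)"])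
      (use tensor_bilinear in \<open>auto simp: bilinear_def
          intro: differentiable_derivD tensor_derivative[OF a] has_derivative_ident\<close>)
  moreover have "((\<lambda>\<eta>. tensor \<eta> \<eta> w) has_derivative (\<lambda>z. tensor a w z)) (at a)"
    by (rule has_derivative_transform_open[OF has_derivative_half_deriv[OF a], of "- {0}"])
      (use a in \<open>auto simp: tensor_Euler\<close>)
  ultimately have "(\<lambda>h. frechet_derivative (\<lambda>\<eta>. tensor \<eta> a w) (at a) h + tensor a h w) = (\<lambda>z. tensor a w z)"
    by (rule has_derivative_unique)
  from fun_cong[OF this, of z] show ?thesis by (simp add: tensor_sym[of a z w])
qed

lemma fundamental_tensor_norm_fun:
  assumes a: "a \<noteq> 0"
  shows "fundamental_tensor norm_fun a u v = tensor a u v"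
proof -
  have inner: "deriv (\<lambda>t. (norm_fun (b + t *\<^sub>R v))\<^sup>2) 0 = 2 * half_deriv b v" if "b \<noteq> 0" for b
  proof -
    have "((\<lambda>t. (norm_fun (b + t *\<^sub>R v))\<^sup>2) has_derivative (\<lambda>t. 2 * half_deriv b (t *\<^sub>R v))) (at 0)"
      by (rule has_derivative_compose[where f="\<lambda>t. b + t *\<^sub>R v" and g="\<lambda>a. (norm_fun a)\<^sup>2" and x=0])
        (use has_derivative_norm_fun_sq[OF that] in \<open>auto intro!: derivative_eq_intros\<close>)
    then have "((\<lambda>t. (norm_fun (b + t *\<^sub>R v))\<^sup>2) has_field_derivative 2 * half_deriv b v) (at 0)"
      unfolding has_field_derivative_def
      by (rule has_derivative_eq_rhs) (auto simp: half_deriv_def ip_simps algebra_simps)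
    then show ?thesis by (rule DERIV_imp_deriv)
  qed
  have "((\<lambda>s. 2 * half_deriv (a + s *\<^sub>R u) v) has_derivative (\<lambda>s. 2 * tensor a v (s *\<^sub>R u))) (at 0)"
    by (intro has_derivative_mult_right
        has_derivative_compose[where f="\<lambda>t. a + t *\<^sub>R u" and g="\<lambda>a. half_deriv a v" and x=0])
      (use has_derivative_half_deriv[OF a] in \<open>auto intro!: derivative_eq_intros\<close>)
  then have D: "((\<lambda>s. 2 * half_deriv (a + s *\<^sub>R u) v) has_field_derivative 2 * tensor a v u) (at 0)"
    unfolding has_field_derivative_def
    by (rule has_derivative_eq_rhs) (auto simp: bilinear_rmul[OF tensor_bilinear])
  \<comment> \<open>The outer derivative needs the inner one for all \<open>s\<close> near 0, and
    its formula holds away from the zero vector.\<close>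
  have "((\<lambda>s. a + s *\<^sub>R u) \<longlongrightarrow> a + 0 *\<^sub>R u) (at 0)" by (intro tendsto_intros)
  then have "eventually (\<lambda>s. a + s *\<^sub>R u \<noteq> 0) (at 0)"
    using a by (intro tendsto_imp_eventually_ne) auto
  then have "eventually (\<lambda>s. a + s *\<^sub>R u \<noteq> 0) (nhds 0)"
    using a by (simp add: eventually_nhds_conv_at)
  then have "eventually (\<lambda>s. deriv (\<lambda>t. (norm_fun (a + s *\<^sub>R u + t *\<^sub>R v))\<^sup>2) 0 = 2 * half_deriv (a + s *\<^sub>R u) v) (nhds 0)"
    by (rule eventually_mono) (rule inner)
  then have "deriv (\<lambda>s. deriv (\<lambda>t. (norm_fun (a + s *\<^sub>R u + t *\<^sub>R v))\<^sup>2) 0) 0 = deriv (\<lambda>s. 2 * half_deriv (a + s *\<^sub>R u) v) 0"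
    by (rule deriv_cong_ev) simp
  also have "\<dots> = 2 * tensor a v u" using D by (rule DERIV_imp_deriv)
  finally show ?thesis unfolding fundamental_tensor_def by (simp add: tensor_sym[of a u v])
qed

text \<open>Replacing \<open>U\<close> by \<open>V\<close> multiplies the numerator and the Gram
  determinant by \<open>a\<^sup>2\<close> each, so the quotient depends on the flag alone. Since
  \<open>Z\<close> is orthogonal to \<open>Y\<close> and \<open>X\<close>, only the
  \<open>ip v w\<close> term of \<open>tensor\<close> survives in the numerator.\<close>

lemma flag_quotient:
  assumes Y: "ip Y Y = 1" and U: "ip U U = 1" and YU: "ip Y U = 0"
    and Z: "ip Y Z = 0" "ip X Z = 0" and a: "a \<noteq> 0" and V_def: "V = a *\<^sub>R U + b *\<^sub>R Y"
  shows "tensor Y (a *\<^sub>R Z) V / (tensor Y Y Y * tensor Y V V - (tensor Y Y V)\<^sup>2) =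
    (1 - ip Y X)\<^sup>2 * (ip Z U * (1 - ip Y X) * (1 - 2 * ip Y X)) /
    ((1 - ip Y X) * (1 - 2 * ip Y X) + 2 * (ip U X)\<^sup>2)"
proof -
  define k s c where "k = rden Y" and "s = ip Y X" and "c = ip U X"
  have Y0: "Y \<noteq> 0" using Y by (auto simp: ip_simps)
  have r: "rad Y = 1" using Y by (simp add: rad_def)
  have XY: "ip X Y = s" "ip X U = c" using ip_sym by (auto simp: s_def c_def)
  have d: "1 - s > 0" using den_pos[OF Y0] by (simp add: den_def r XY)
  have kd: "k * (1 - s) = 1" using d by (simp add: k_def rden_def den_def r XY)
  note T = bilinear_ladd[OF tensor_bilinear] bilinear_radd[OF tensor_bilinear]
    bilinear_lmul[OF tensor_bilinear] bilinear_rmul[OF tensor_bilinear]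
  have UZ: "ip Z Y = 0" using Z ip_sym by metis
  have t1: "tensor Y Z U = (2 * k ^ 2 - k ^ 3) * ip Z U" "tensor Y Z Y = 0"
    unfolding tensor_def k_def[symmetric] r by (simp_all add: Z UZ YU Y XY)
  have t2: "tensor Y Y Y = k ^ 2"
  proof -
    have "half_deriv Y Y = 2 * k ^ 2 - k ^ 2 * (k * (1 - s))"
      unfolding half_deriv_def k_def[symmetric] r by (simp add: Y XY algebra_simps power2_eq_square power3_eq_cube)
    then show ?thesis unfolding tensor_Euler[OF Y0] kd by simp
  qed
  have t3: "tensor Y Y U = k ^ 3 * c"
    unfolding tensor_Euler[OF Y0] half_deriv_def k_def[symmetric] r by (simp add: YU XY)
  have t4: "tensor Y U U = 2 * k ^ 2 - k ^ 3 + 3 * k ^ 4 * c ^ 2"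
    unfolding tensor_def k_def[symmetric] r by (simp add: U YU XY power2_eq_square)
  have num: "tensor Y (a *\<^sub>R Z) V = a\<^sup>2 * ((2 * k ^ 2 - k ^ 3) * ip Z U)"
    unfolding V_def by (simp add: T t1 power2_eq_square)
  have den: "tensor Y Y Y * tensor Y V V - (tensor Y Y V)\<^sup>2 =
      a\<^sup>2 * (tensor Y Y Y * tensor Y U U - (tensor Y Y U)\<^sup>2)"
    unfolding V_def T tensor_sym[of Y U Y] by (simp add: algebra_simps power2_eq_square)
  have k: "k = 1 / (1 - s)" using kd d by (simp add: field_simps)
  \<comment> \<open>The fraction is left unreduced so that its denominator is a factor of the one in
    \<open>d2\<close> and cancels in \<open>quot\<close>.\<close>
  have n2: "2 * k ^ 2 - k ^ 3 = (1 - s) * (1 - 2 * s) / (1 - s) ^ 4"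
  proof -
    have "(2 * k ^ 2 - k ^ 3) * t ^ 4 = 2 * (k * t)\<^sup>2 * t\<^sup>2 - (k * t) ^ 3 * t" for t
      by (simp add: algebra_simps eval_nat_numeral)
    from this[of "1 - s"] have "(2 * k ^ 2 - k ^ 3) * (1 - s) ^ 4 = (1 - s) * (1 - 2 * s)"
      unfolding kd by (simp add: algebra_simps power2_eq_square)
    then show ?thesis using d by (simp add: eq_divide_eq)
  qed
  \<comment> \<open>The term \<open>3 * k ^ 6 * c\<^sup>2\<close> loses one copy to the square of
    \<open>tensor Y Y U\<close>. The remaining coefficient 2 becomes the 8 of the final
    formula.\<close>
  have d2: "k ^ 2 * (2 * k ^ 2 - k ^ 3 + 3 * k ^ 4 * c ^ 2) - (k ^ 3 * c)\<^sup>2 =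
      ((1 - s) * (1 - 2 * s) + 2 * c\<^sup>2) / ((1 - s) ^ 4 * (1 - s)\<^sup>2)"
  proof -
    have "k ^ 2 * (2 * k ^ 2 - k ^ 3 + 3 * k ^ 4 * c ^ 2) - (k ^ 3 * c)\<^sup>2 = k ^ 2 * (2 * k ^ 2 - k ^ 3) + 2 * k ^ 6 * c\<^sup>2"
      by (simp add: algebra_simps eval_nat_numeral)
    also have "\<dots> = ((1 - s) * (1 - 2 * s) + 2 * c\<^sup>2) / (1 - s) ^ 6"
      unfolding n2 unfolding k using d by (simp add: add_divide_distrib power_divide flip: power_add)
    finally show ?thesis by (simp flip: power_add)
  qed
  have quot: "a\<^sup>2 * (n / q * i) / (a\<^sup>2 * (D / (q * t))) = t * (i * n) / D" if "q > 0" "t > 0" for n q i D t :: real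
    using a that by simp
  show ?thesis
    unfolding num den unfolding t2 t3 t4 unfolding d2 unfolding n2 s_def[symmetric] c_def[symmetric]
    by (subst quot) (use d in \<open>simp_all add: mult.assoc\<close>)
qed

end


section \<open>The Chern connection in an invariant frame\<close>

lemma fundamental_tensor_linear:
  assumes "linear K"
  shows "fundamental_tensor (\<lambda>y. N (K y)) y u v = fundamental_tensor N (K y) (K u) (K v)"
  unfolding fundamental_tensor_def by (simp add: linear_add[OF assms] linear_scale[OF assms])

text \<open>Putting \<open>v = w = y\<close>, then \<open>u = y\<close>, shows that the difference \<open>D\<close> of two solutions
  satisfies \<open>D y y = 0\<close> and that \<open>D \<cdot> y\<close> is self-adjoint; then \<open>u = y\<close> gives \<open>D \<cdot> y = 0\<close>,
  and finally \<open>D u\<close> is skew while \<open>D\<close> is symmetric. Of the Cartan term \<open>C\<close> only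
  \<open>C y = 0\<close> enters.\<close>

lemma chern_equations_unique:
  fixes g :: "'e::euclidean_space \<Rightarrow> 'e \<Rightarrow> real"
  assumes g: "bilinear g" "\<And>v w. g v w = g w v" "\<And>v. (\<And>w. g v w = 0) \<Longrightarrow> v = 0"
    and C: "\<And>v w. linear (C v w)" "\<And>w z. C y w z = 0"
    and \<Gamma>: "bilinear \<Gamma>" "\<And>u v. \<Gamma> u v = \<Gamma> v u"
      "\<And>u v w. c u v w - C v w (\<Gamma> u y) = g (\<Gamma> u v) w + g v (\<Gamma> u w)"
    and \<Gamma>': "bilinear \<Gamma>'" "\<And>u v. \<Gamma>' u v = \<Gamma>' v u"
      "\<And>u v w. c u v w - C v w (\<Gamma>' u y) = g (\<Gamma>' u v) w + g v (\<Gamma>' u w)"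
  shows "\<Gamma> = \<Gamma>'"
proof -
  define D where "D u v = \<Gamma> u v - \<Gamma>' u v" for u v
  note g_simps = bilinear_lsub[OF g(1)] bilinear_rsub[OF g(1)]
  have D_sym: "D u v = D v u" for u v using \<Gamma>(2) \<Gamma>'(2) by (simp add: D_def)
  have D: "- C v w (D u y) = g (D u v) w + g v (D u w)" for u v w
    using \<Gamma>(3)[of u v w] \<Gamma>'(3)[of u v w] by (simp add: D_def g_simps linear_diff[OF C(1)])
  have 1: "g (D u y) w = - g y (D u w)" for u w
    using D[of y w u] C(2) by simp
  have 2: "g (D u y) w = g (D w y) u" for u w
    using 1[of u w] 1[of w u] D_sym[of u w] by simp
  have 3: "g (D u y) y = 0" for u
    using 1[of u y] g(2)[of y "D u y"] by simp
  have 4: "D y y = 0"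
    using g(3)[of "D y y"] 2[of y] 3 by simp
  have 5: "g (D v y) w = 0" for v w
  proof -
    have "C v w (D y y) = 0" using 4 linear_0[OF C(1)] by simp
    then have "g (D v y) w + g (D w y) v = 0"
      using D[of v w y] D_sym[of y v] D_sym[of y w] g(2)[of v "D w y"] by simp
    then show ?thesis using 2[of v w] by simp
  qed
  have 6: "D v y = 0" for v using g(3) 5 by blast
  have 7: "g (D u v) w = - g (D u w) v" for u v w
    using D[of v w u] 6 linear_0[OF C(1)] g(2)[of v "D u w"] by simp
  have "g (D u v) w = 0" for u v w
    using 7[of u v w] 7[of w u v] 7[of v w u] D_sym[of w u] D_sym[of v w] D_sym[of u v] by simp
  then have "D u v = 0" for u v using g(3) by blast
  then show ?thesis by (auto simp: D_def fun_eq_iff)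
qed

text \<open>What remains of the group near the identity: a frame \<open>E\<close> whose brackets
  have constant coefficients \<open>br\<close>, its inverse \<open>th\<close>, an
  \<open>ad\<close>-invariant inner product, and a metric \<open>L\<close> obtained at each point by
  pulling back one Minkowski norm along \<open>th x\<close>.\<close>

locale invariant_frame = matsumoto_norm ip X
  for ip :: "'e::euclidean_space \<Rightarrow> 'e \<Rightarrow> real" and X +
  fixes S :: "'e set" and e0 :: 'e and E th :: "'e \<Rightarrow> 'e \<Rightarrow> 'e" and br :: "'e \<Rightarrow> 'e \<Rightarrow> 'e"
    and L :: "'e \<Rightarrow> 'e \<Rightarrow> real"
  assumes S_open: "open S" and e0_in: "e0 \<in> S"
    and E_linear: "x \<in> S \<Longrightarrow> linear (E x)"
    and E_base: "E e0 a = a"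
    and th_E: "x \<in> S \<Longrightarrow> th x (E x a) = a"
    and E_th: "x \<in> S \<Longrightarrow> E x (th x v) = v"
    and E_smooth: "smooth_on (\<lambda>x. E x a) S"
    and th_differentiable: "x \<in> S \<Longrightarrow> (\<lambda>x. th x v) differentiable (at x)"
    and frame_bracket: "x \<in> S \<Longrightarrow>
      coord_bracket (\<lambda>z. E z a) (\<lambda>z. E z b) x = E x (br a b)"
    and ad_invariant: "ip (br c a) b + ip a (br c b) = 0"
    and X_central: "br c X = 0"
    and L_eq: "x \<in> S \<Longrightarrow> L x y = norm_fun (th x y)"
begin

definition dE :: "'e \<Rightarrow> 'e \<Rightarrow> 'e \<Rightarrow> 'e" where
  "dE x u a = frechet_derivative (\<lambda>z. E z a) (at x) u"

text \<open>The Levi-Civita symbol determined by \<open>\<nabla>\<^bsub>E a\<^esub> (E b) = E [a, b] / 2\<close>.\<close>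
definition chris :: "'e \<Rightarrow> 'e \<Rightarrow> 'e \<Rightarrow> 'e" where
  "chris x u v = (1 / 2) *\<^sub>R E x (br (th x u) (th x v)) - dE x u (th x v)"

lemma frame_bracket': "x \<in> S \<Longrightarrow> dE x (E x a) b - dE x (E x b) a = E x (br a b)"
  using frame_bracket[of x a b] by (simp add: coord_bracket_def dE_def)

lemma th_linear:
  assumes "x \<in> S"
  shows "linear (th x)"
proof (rule linearI)
  note E = linear_add[OF E_linear[OF assms]] linear_scale[OF E_linear[OF assms]]
  have "th x (u + v) = th x (E x (th x u) + E x (th x v))" for u v
    by (simp add: E_th[OF assms])
  then show "th x (u + v) = th x u + th x v" for u v
    by (simp add: E(1)[symmetric] th_E[OF assms])
  have "th x (r *\<^sub>R u) = th x (r *\<^sub>R E x (th x u))" for r u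
    by (simp add: E_th[OF assms])
  then show "th x (r *\<^sub>R u) = r *\<^sub>R th x u" for r u
    by (simp add: E(2)[symmetric] th_E[OF assms])
qed

lemma th_nonzero: "x \<in> S \<Longrightarrow> y \<noteq> 0 \<Longrightarrow> th x y \<noteq> 0"
  using E_th[of x y] linear_0[OF E_linear[of x]] by force

lemma th_base: "th e0 v = v"
  using th_E[OF e0_in, of v] by (simp add: E_base)

lemma E_has_derivative:
  assumes "x \<in> S"
  shows "((\<lambda>z. E z a) has_derivative (\<lambda>u. dE x u a)) (at x)"
  unfolding dE_def using smooth_on_has_derivative[OF E_smooth assms] by simp

lemma dE_bilinear:
  assumes "x \<in> S"
  shows "bilinear (dE x)"
  unfolding bilinear_def
proof (intro conjI allI)
  show "linear (\<lambda>u. dE x u a)" for a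
    using has_derivative_linear[OF E_has_derivative[OF assms]] .
  show "linear (dE x u)" for u
  proof (rule linearI)
    fix a b :: 'e and r :: real
    have "((\<lambda>z. E z (a + b)) has_derivative (\<lambda>u. dE x u a + dE x u b)) (at x)"
      by (rule has_derivative_transform_open
          [OF has_derivative_add[OF E_has_derivative[OF assms] E_has_derivative[OF assms]] S_open assms])
        (simp add: linear_add[OF E_linear])
    then show "dE x u (a + b) = dE x u a + dE x u b"
      unfolding dE_def using has_derivative_frechet_eq by metis
    have "((\<lambda>z. E z (r *\<^sub>R a)) has_derivative (\<lambda>u. r *\<^sub>R dE x u a)) (at x)"
      by (rule has_derivative_transform_open
          [OF has_derivative_scaleR_right[OF E_has_derivative[OF assms]] S_open assms])
        (simp add: linear_scale[OF E_linear])
    then show "dE x u (r *\<^sub>R a) = r *\<^sub>R dE x u a"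
      unfolding dE_def using has_derivative_frechet_eq by metis
  qed
qed

lemma br_eq: "br a b = dE e0 a b - dE e0 b a"
  using frame_bracket'[OF e0_in, of a b] by (simp add: E_base)

lemma br_bilinear: "bilinear br"
  unfolding br_eq[abs_def] using dE_bilinear[OF e0_in]
  by (auto simp: bilinear_def intro!: linear_compose_sub)

lemma br_swap: "br a b = - br b a"
  by (simp add: br_eq)

text \<open>The identity \<open>E z (th z v) = v\<close> is differentiated by the product rule and
  solved for the derivative of \<open>th\<close>.\<close>

lemma th_has_derivative:
  assumes "x \<in> S"
  shows "((\<lambda>z. th z v) has_derivative (\<lambda>u. - th x (dE x u (th x v)))) (at x)"
proof -
  define D where "D = frechet_derivative (\<lambda>z. th z v) (at x)"
  have D: "((\<lambda>z. th z v) has_derivative D) (at x)"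
    unfolding D_def by (rule differentiable_derivD[OF th_differentiable[OF assms]])
  have "((\<lambda>z. E z (th z v)) has_derivative (\<lambda>u. dE x u (th x v) + E x (D u))) (at x)"
    by (rule has_derivative_linear_apply[where f=E and f'="\<lambda>a u. dE x u a" and S=S])
      (use D E_has_derivative S_open assms E_linear in auto)
  moreover have "((\<lambda>z. E z (th z v)) has_derivative (\<lambda>u. 0)) (at x)"
    by (rule has_derivative_transform_open[OF has_derivative_const[of v] S_open assms]) (simp add: E_th)
  ultimately have "(\<lambda>u. dE x u (th x v) + E x (D u)) = (\<lambda>u. 0)"
    by (rule has_derivative_unique)
  then have "E x (D u) = - dE x u (th x v)" for u
    by (metis add_eq_0_iff)
  then have "D u = - th x (dE x u (th x v))" for u
    using th_E[OF assms, of "D u"] linear_neg[OF th_linear[OF assms]] by simp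
  then have "D = (\<lambda>u. - th x (dE x u (th x v)))" by blast
  then show ?thesis using D by simp
qed

lemma chris_bilinear:
  assumes "x \<in> S"
  shows "bilinear (chris x)"
  unfolding bilinear_def chris_def
  by (auto intro!: linearI simp: algebra_simps
      bilinear_ladd[OF br_bilinear] bilinear_radd[OF br_bilinear]
      bilinear_lmul[OF br_bilinear] bilinear_rmul[OF br_bilinear]
      bilinear_ladd[OF dE_bilinear[OF assms]] bilinear_radd[OF dE_bilinear[OF assms]]
      bilinear_lmul[OF dE_bilinear[OF assms]] bilinear_rmul[OF dE_bilinear[OF assms]]
      linear_add[OF th_linear[OF assms]] linear_scale[OF th_linear[OF assms]]
      linear_add[OF E_linear[OF assms]] linear_scale[OF E_linear[OF assms]])

text \<open>Torsion-freeness. The skew part of the \<open>dE\<close> term is governed by the bracket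
  of the frame, and the two half brackets in \<open>chris x u v\<close> and
  \<open>chris x v u\<close> differ by exactly this amount.\<close>

lemma chris_sym:
  assumes "x \<in> S"
  shows "chris x u v = chris x v u"
proof -
  have "dE x u (th x v) - dE x v (th x u) = E x (br (th x u) (th x v))"
    using frame_bracket'[OF assms, of "th x u" "th x v"] by (simp add: E_th[OF assms])
  moreover have "E x (br (th x v) (th x u)) = - E x (br (th x u) (th x v))"
    by (subst br_swap) (simp add: linear_neg[OF E_linear[OF assms]])
  moreover have "p = (1/2) *\<^sub>R p + (1/2) *\<^sub>R p" for p :: 'e
    by (simp flip: scaleR_add_left)
  ultimately show ?thesis unfolding chris_def by (simp add: algebra_simps)
qed

lemma th_chris:
  assumes "x \<in> S"
  shows "th x (chris x u v) = (1 / 2) *\<^sub>R br (th x u) (th x v) - th x (dE x u (th x v))"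
  unfolding chris_def
  by (simp add: linear_diff[OF th_linear[OF assms]] linear_scale[OF th_linear[OF assms]] th_E[OF assms])

lemma fundamental_tensor_L:
  assumes "x \<in> S" "y \<noteq> 0"
  shows "fundamental_tensor (L x) y v w = tensor (th x y) (th x v) (th x w)"
proof -
  have "L x = (\<lambda>y. norm_fun (th x y))" using L_eq[OF assms(1)] by auto
  then show ?thesis
    by (simp add: fundamental_tensor_linear[OF th_linear[OF assms(1)]]
        fundamental_tensor_norm_fun[OF th_nonzero[OF assms]])
qed

lemma tensor_has_derivative:
  assumes "a \<noteq> 0"
  shows "((\<lambda>\<eta>. tensor \<eta> v w) has_derivative frechet_derivative (\<lambda>\<eta>. tensor \<eta> v w) (at a)) (at a)"
  by (rule differentiable_derivD[OF tensor_derivative(1)[OF assms]])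

lemma fundamental_tensor_L_derivative_fibre:
  assumes "x \<in> S" "y \<noteq> 0"
  shows "((\<lambda>\<eta>. fundamental_tensor (L x) \<eta> v w) has_derivative
    (\<lambda>z. frechet_derivative (\<lambda>\<eta>. tensor \<eta> (th x v) (th x w)) (at (th x y)) (th x z))) (at y)"
proof (rule has_derivative_transform_open[of _ _ _ "- {0}"])
  have "(th x has_derivative th x) (at y)"
    using th_linear[OF assms(1)] linear_imp_has_derivative by blast
  then show "((\<lambda>\<eta>. tensor (th x \<eta>) (th x v) (th x w)) has_derivative
    (\<lambda>z. frechet_derivative (\<lambda>\<eta>. tensor \<eta> (th x v) (th x w)) (at (th x y)) (th x z))) (at y)"
    by (rule has_derivative_compose) (rule tensor_has_derivative[OF th_nonzero[OF assms]])
qed (use assms fundamental_tensor_L in auto)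

text \<open>The coframe moves the reference vector and both arguments. The reference vector, in
  which \<open>tensor\<close> is not linear, is treated by the chain rule; the two linear arguments
  are then added one at a time.\<close>

lemma fundamental_tensor_L_derivative_base:
  assumes x: "x \<in> S" and y: "y \<noteq> 0"
  shows "((\<lambda>z. fundamental_tensor (L z) y v w) has_derivative
    (\<lambda>u. frechet_derivative (\<lambda>\<eta>. tensor \<eta> (th x v) (th x w)) (at (th x y)) (- th x (dE x u (th x y)))
       + tensor (th x y) (- th x (dE x u (th x v))) (th x w)
       + tensor (th x y) (th x v) (- th x (dE x u (th x w))))) (at x)"
proof (rule has_derivative_transform_open[OF _ S_open x])
  have 1: "((\<lambda>z. tensor (th z y) v' w') has_derivative
    (\<lambda>u. frechet_derivative (\<lambda>\<eta>. tensor \<eta> v' w') (at (th x y)) (- th x (dE x u (th x y))))) (at x)" for v' w'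
    by (rule has_derivative_compose[OF th_has_derivative[OF x] tensor_has_derivative[OF th_nonzero[OF x y]]])
  have 2: "((\<lambda>z. tensor (th z y) (th z v) w') has_derivative
    (\<lambda>u. frechet_derivative (\<lambda>\<eta>. tensor \<eta> (th x v) w') (at (th x y)) (- th x (dE x u (th x y)))
       + tensor (th x y) (- th x (dE x u (th x v))) w')) (at x)" for w'
    by (rule has_derivative_linear_apply[where f="\<lambda>z v'. tensor (th z y) v' w'" and S=UNIV
          and f'="\<lambda>v' u. frechet_derivative (\<lambda>\<eta>. tensor \<eta> v' w') (at (th x y)) (- th x (dE x u (th x y)))"])
      (use 1 th_has_derivative[OF x] tensor_bilinear in \<open>auto simp: bilinear_def\<close>)
  show "((\<lambda>z. tensor (th z y) (th z v) (th z w)) has_derivative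
    (\<lambda>u. frechet_derivative (\<lambda>\<eta>. tensor \<eta> (th x v) (th x w)) (at (th x y)) (- th x (dE x u (th x y)))
       + tensor (th x y) (- th x (dE x u (th x v))) (th x w)
       + tensor (th x y) (th x v) (- th x (dE x u (th x w))))) (at x)"
    by (rule has_derivative_linear_apply[where f="\<lambda>z w'. tensor (th z y) (th z v) w'" and S=UNIV
          and f'="\<lambda>w' u. frechet_derivative (\<lambda>\<eta>. tensor \<eta> (th x v) w') (at (th x y)) (- th x (dE x u (th x y)))
       + tensor (th x y) (- th x (dE x u (th x v))) w'"])
      (use 2 th_has_derivative[OF x] tensor_bilinear in \<open>auto simp: bilinear_def\<close>)
qed (use y fundamental_tensor_L in auto)

text \<open>After substitution of \<open>th_chris\<close> the \<open>dE\<close> terms cancel in the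
  compatibility equation, and what is left is one half of \<open>tensor_invariant\<close> for
  bracketing with \<open>th x u\<close>. Positivity of the tensor provides the nondegeneracy for
  uniqueness. The right-hand side is free of \<open>y\<close>.\<close>

lemma chern_symbol_L:
  assumes x: "x \<in> S" and y: "y \<noteq> 0"
  shows "chern_symbol L x y = chris x"
proof -
  define C where "C v w = frechet_derivative (\<lambda>\<eta>. fundamental_tensor (L x) \<eta> v w) (at y)" for v w
  define g where "g = fundamental_tensor (L x) y"
  define c where "c u v w = frechet_derivative (\<lambda>z. fundamental_tensor (L z) y v w) (at x) u" for u v w
  define DT where "DT v w = frechet_derivative (\<lambda>\<eta>. tensor \<eta> (th x v) (th x w)) (at (th x y))" for v w
  have g: "g v w = tensor (th x y) (th x v) (th x w)" for v w
    unfolding g_def by (rule fundamental_tensor_L[OF x y])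
  have C: "C v w z = DT v w (th x z)" for v w z
    unfolding C_def DT_def using has_derivative_frechet_eq[OF fundamental_tensor_L_derivative_fibre[OF x y]] by simp
  have c: "c u v w = DT v w (- th x (dE x u (th x y)))
       + tensor (th x y) (- th x (dE x u (th x v))) (th x w)
       + tensor (th x y) (th x v) (- th x (dE x u (th x w)))" for u v w
    unfolding c_def DT_def using has_derivative_frechet_eq[OF fundamental_tensor_L_derivative_base[OF x y]] by simp
  have DT_linear: "linear (DT v w)" for v w
    unfolding DT_def using has_derivative_linear[OF tensor_has_derivative[OF th_nonzero[OF x y]]] .
  note T = bilinear_ladd[OF tensor_bilinear] bilinear_radd[OF tensor_bilinear]
    bilinear_lsub[OF tensor_bilinear] bilinear_rsub[OF tensor_bilinear]
    bilinear_lmul[OF tensor_bilinear] bilinear_rmul[OF tensor_bilinear]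
    bilinear_lneg[OF tensor_bilinear] bilinear_rneg[OF tensor_bilinear]
  have g_bil: "bilinear g"
    unfolding bilinear_def g
    by (auto intro!: linearI simp: T linear_add[OF th_linear[OF x]] linear_scale[OF th_linear[OF x]])
  have g_sym: "g v w = g w v" for v w
    unfolding g by (rule tensor_sym)
  have g_nd: "v = 0" if "\<And>w. g v w = 0" for v
    using that[of v] tensor_pos[OF th_nonzero[OF x y], of "th x v"] th_nonzero[OF x, of v] unfolding g by force
  have C_linear: "linear (C v w)" for v w
    unfolding C using linear_compose[OF th_linear[OF x] DT_linear] by (simp add: comp_def)
  have C_radial: "C y w z = 0" for w z
    unfolding C DT_def by (rule tensor_radial_derivative[OF th_nonzero[OF x y]])
  have compat: "c u v w - C v w (chris x u y) = g (chris x u v) w + g v (chris x u w)" for u v w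
  proof -
    define K where "K = br (th x u)"
    have inv: "DT v w (K (th x y)) + tensor (th x y) (K (th x v)) (th x w) + tensor (th x y) (th x v) (K (th x w)) = 0"
      unfolding DT_def
    proof (rule tensor_invariant[OF th_nonzero[OF x y]])
      show "ip (K a) b + ip a (K b) = 0" for a b unfolding K_def by (rule ad_invariant)
      \<comment> \<open>Centrality of \<open>X\<close> enters here: by skewness every bracket is
        orthogonal to a central vector.\<close>
      then show "ip X (K a) = 0" for a
        unfolding K_def using ad_invariant[of "th x u" X a] X_central by (simp add: ip_simps)
    qed
    show ?thesis
      unfolding c C g th_chris[OF x] K_def[symmetric]
      using inv
      by (simp add: T linear_diff[OF DT_linear] linear_scale[OF DT_linear] linear_neg[OF DT_linear] algebra_simps)
  qed
  show ?thesis
    unfolding chern_symbol_def C_def[symmetric] g_def[symmetric] c_def[symmetric]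
  proof (rule the_equality)
    show "bilinear (chris x) \<and> (\<forall>u v. chris x u v = chris x v u) \<and>
      (\<forall>u v w. c u v w - C v w (chris x u y) = g (chris x u v) w + g v (chris x u w))"
      using chris_bilinear[OF x] chris_sym[OF x] compat by blast
    fix \<Gamma> assume \<Gamma>: "bilinear \<Gamma> \<and> (\<forall>u v. \<Gamma> u v = \<Gamma> v u) \<and>
      (\<forall>u v w. c u v w - C v w (\<Gamma> u y) = g (\<Gamma> u v) w + g v (\<Gamma> u w))"
    show "\<Gamma> = chris x"
      by (rule chern_equations_unique[where g=g and C=C and y=y and c=c])
        (use \<Gamma> g_bil g_sym g_nd C_linear C_radial compat chris_bilinear[OF x] chris_sym[OF x] in blast)+
  qed
qed

section \<open>Curvature at the base point\<close>

lemma dE_has_derivative: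
  assumes "x \<in> S"
  shows "((\<lambda>z. dE z u a) has_derivative frechet_derivative (\<lambda>z. dE z u a) (at x)) (at x)"
  unfolding dE_def by (rule smooth_on_has_derivative[OF smooth_on_deriv[OF E_smooth] assms])

lemma dE_derivative_sym:
  "frechet_derivative (\<lambda>z. dE z u a) (at e0) v = frechet_derivative (\<lambda>z. dE z v a) (at e0) u"
  unfolding dE_def by (rule smooth_on_symmetric_second_derivative[OF E_smooth S_open e0_in])

lemma chris_base: "chris e0 u v = (1 / 2) *\<^sub>R br u v - dE e0 u v"
  by (simp add: chris_def th_base E_base)

lemma chris_has_derivative:
  "((\<lambda>z. chris z v w) has_derivative
     (\<lambda>u. (1 / 2) *\<^sub>R (dE e0 u (br v w) - br (dE e0 u v) w - br v (dE e0 u w))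
        - (frechet_derivative (\<lambda>z. dE z v w) (at e0) u - dE e0 v (dE e0 u w)))) (at e0)"
proof -
  have th: "((\<lambda>z. th z v) has_derivative (\<lambda>u. - dE e0 u v)) (at e0)" for v
    using th_has_derivative[OF e0_in, of v] by (simp add: th_base)
  have "bounded_bilinear br" using br_bilinear bilinear_conv_bounded_bilinear by blast
  then have "((\<lambda>z. br (th z v) (th z w)) has_derivative
      (\<lambda>u. br (th e0 v) (- dE e0 u w) + br (- dE e0 u v) (th e0 w))) (at e0)"
    by (rule bounded_bilinear.FDERIV[OF _ th th])
  then have brth: "((\<lambda>z. br (th z v) (th z w)) has_derivative
      (\<lambda>u. - br (dE e0 u v) w - br v (dE e0 u w))) (at e0)"
    by (rule has_derivative_eq_rhs)
      (simp add: fun_eq_iff th_base bilinear_lneg[OF br_bilinear] bilinear_rneg[OF br_bilinear])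
  have 1: "((\<lambda>z. E z (br (th z v) (th z w))) has_derivative
      (\<lambda>u. dE e0 u (br (th e0 v) (th e0 w)) + E e0 (- br (dE e0 u v) w - br v (dE e0 u w)))) (at e0)"
    by (rule has_derivative_linear_apply[where f=E and S=S and f'="\<lambda>a u. dE e0 u a"
          and g="\<lambda>z. br (th z v) (th z w)", OF E_has_derivative[OF e0_in] brth S_open e0_in E_linear])
  have 2: "((\<lambda>z. dE z v (th z w)) has_derivative
      (\<lambda>u. frechet_derivative (\<lambda>z. dE z v (th e0 w)) (at e0) u + dE e0 v (- dE e0 u w))) (at e0)"
    by (rule has_derivative_linear_apply[where f="\<lambda>z. dE z v" and S=S
          and f'="\<lambda>a. frechet_derivative (\<lambda>z. dE z v a) (at e0)", OF dE_has_derivative[OF e0_in] th S_open e0_in])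
      (use dE_bilinear in \<open>auto simp: bilinear_def\<close>)
  show ?thesis
    unfolding chris_def
    by (rule has_derivative_eq_rhs[OF has_derivative_diff[OF has_derivative_scaleR_right[OF 1] 2]])
      (simp add: fun_eq_iff th_base E_base bilinear_rneg[OF dE_bilinear[OF e0_in]] algebra_simps)
qed

lemma chern_deriv_const:
  assumes "x \<in> S" "y \<noteq> 0"
  shows "chern_deriv L (\<lambda>_. v) (\<lambda>z _. w) x y = chris x v w"
  by (simp add: chern_deriv_def chern_symbol_L[OF assms])

text \<open>The inner derivative is a section over the pulled-back bundle, so it must be known near
  \<open>e0\<close> as well as near \<open>y\<close>. It equals \<open>chris z v w\<close>, which is
  constant along the fibre, and hence the vertical term vanishes.\<close>

lemma chern_deriv_chern_deriv_const:
  assumes y: "y \<noteq> 0"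
  shows "chern_deriv L (\<lambda>_. u) (chern_deriv L (\<lambda>_. v) (\<lambda>z _. w)) e0 y =
    (1 / 2) *\<^sub>R (dE e0 u (br v w) - br (dE e0 u v) w - br v (dE e0 u w))
        - (frechet_derivative (\<lambda>z. dE z v w) (at e0) u - dE e0 v (dE e0 u w))
    + chris e0 u (chris e0 v w)"
proof -
  have "frechet_derivative (\<lambda>z. chern_deriv L (\<lambda>_. v) (\<lambda>z _. w) z y) (at e0) =
      frechet_derivative (\<lambda>z. chris z v w) (at e0)"
    by (rule frechet_derivative_cong_open[OF S_open e0_in]) (rule chern_deriv_const[OF _ y])
  moreover have "frechet_derivative (chern_deriv L (\<lambda>_. v) (\<lambda>z _. w) e0) (at y) =
      frechet_derivative (\<lambda>_. chris e0 v w) (at y)"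
    by (rule frechet_derivative_cong_open[of "- {0}"]) (use y chern_deriv_const[OF e0_in] in auto)
  ultimately show ?thesis
    unfolding chern_deriv_def[of L "\<lambda>_. u" "chern_deriv L (\<lambda>_. v) (\<lambda>z _. w)"]
    by (simp add: has_derivative_frechet_eq[OF chris_has_derivative] chern_symbol_L[OF e0_in y]
        chern_deriv_const[OF e0_in y])
qed

text \<open>The fields with constant coordinates commute, so the term -1/2 [[u, v], w] has another
  source: the skew part in \<open>u\<close>, \<open>v\<close> of \<open>br (dE e0 u v) w\<close>.
  The second derivatives of the frame and the remaining mixed terms are symmetric in
  \<open>u\<close>, \<open>v\<close> and cancel.\<close>

lemma chern_curvature_const:
  assumes y: "y \<noteq> 0"
  shows "chern_curvature L (\<lambda>_. u) (\<lambda>_. v) (\<lambda>_. w) e0 y =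
    (1 / 4) *\<^sub>R br u (br v w) - (1 / 4) *\<^sub>R br v (br u w) - (1 / 2) *\<^sub>R br (br u v) w"
proof -
  have "coord_bracket (\<lambda>_. u) (\<lambda>_. v) = (\<lambda>_::'e. 0)"
    by (simp add: coord_bracket_def fun_eq_iff)
  then have 0: "chern_deriv L (coord_bracket (\<lambda>_. u) (\<lambda>_. v)) (\<lambda>z _. w) e0 y = 0"
    using chern_deriv_const[OF e0_in y, of 0 w] bilinear_lzero[OF chris_bilinear[OF e0_in]] by simp
  note bil = bilinear_ladd[OF br_bilinear] bilinear_radd[OF br_bilinear]
    bilinear_lsub[OF br_bilinear] bilinear_rsub[OF br_bilinear]
    bilinear_lmul[OF br_bilinear] bilinear_rmul[OF br_bilinear]
    bilinear_ladd[OF dE_bilinear[OF e0_in]] bilinear_radd[OF dE_bilinear[OF e0_in]]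
    bilinear_lsub[OF dE_bilinear[OF e0_in]] bilinear_rsub[OF dE_bilinear[OF e0_in]]
    bilinear_lmul[OF dE_bilinear[OF e0_in]] bilinear_rmul[OF dE_bilinear[OF e0_in]]
  have 1: "br (br u v) w = br (dE e0 u v) w - br (dE e0 v u) w"
    by (subst br_eq[of u v]) (simp add: bil)
  show ?thesis
    unfolding chern_curvature_def 0 chern_deriv_chern_deriv_const[OF y] chris_base 1 dE_derivative_sym[of v w u]
    by (simp add: bil algebra_simps)
qed

text \<open>With \<open>v = w = y\<close> the first term drops out, and the second contributes +1/4
  [[u, y], y] after a swap of the outer bracket, against -1/2 from the third.\<close>

lemma chern_curvature_flag:
  assumes "y \<noteq> 0"
  shows "chern_curvature L (\<lambda>_. u) (\<lambda>_. y) (\<lambda>_. y) e0 y = - (1 / 4) *\<^sub>R br (br u y) y"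
proof -
  have "br y y = 0" by (simp add: br_eq)
  moreover have "br y (br u y) = - br (br u y) y" by (rule br_swap)
  moreover have "(1 / 2) *\<^sub>R p = (1 / 4) *\<^sub>R p + (1 / 4) *\<^sub>R p" for p :: 'e
    by (simp flip: scaleR_add_left)
  ultimately show ?thesis
    by (simp add: chern_curvature_const[OF assms] bilinear_rzero[OF br_bilinear])
qed

text \<open>The flag curvature is the common value over all complementary vectors \<open>V\<close>
  of the flag. Each of them has the form a U + b Y with a nonzero, so \<open>flag_quotient\<close>
  gives one value \<open>Q\<close> for all, and \<open>U\<close> itself shows that no other number
  qualifies.\<close>

lemma flag_curvature_eq:
  assumes F: "F p = norm_fun" and op: "\<And>V. flag_operator A F p Y V = chern_curvature L (\<lambda>_. V) (\<lambda>_. Y) (\<lambda>_. Y) e0 Y"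
    and Y: "ip Y Y = 1" and U: "ip U U = 1" and YU: "ip Y U = 0"
  shows "flag_curvature A F p (span {Y, U}) Y =
    - (1 - ip Y X)\<^sup>2 / (4 * (1 - ip Y X) * (1 - 2 * ip Y X) + 8 * (ip U X)\<^sup>2) *
      (ip (br (br U Y) Y) U * (1 - ip Y X) * (1 - 2 * ip Y X)
       + 3 * ip (br (br U Y) Y) X * ip U X)"
proof -
  have Y0: "Y \<noteq> 0" using Y by (auto simp: ip_simps)
  define Z where "Z = - (1 / 4) *\<^sub>R br (br U Y) Y"
  have YB: "ip Y (br c Y) = 0" for c
    using ad_invariant[of c Y Y] ip_sym[of Y "br c Y"] by simp
  have XB: "ip X (br c v) = 0" for c v
    using ad_invariant[of c X v] X_central[of c] by (simp add: ip_simps)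
  have Z: "ip Y Z = 0" "ip X Z = 0" by (simp_all add: Z_def ip_simps YB XB)
  define Q where "Q = (1 - ip Y X)\<^sup>2 * (ip Z U * (1 - ip Y X) * (1 - 2 * ip Y X)) /
    ((1 - ip Y X) * (1 - 2 * ip Y X) + 2 * (ip U X)\<^sup>2)"
  have quot: "fundamental_tensor (F p) Y (flag_operator A F p Y V) V /
            (fundamental_tensor (F p) Y Y Y * fundamental_tensor (F p) Y V V
             - (fundamental_tensor (F p) Y Y V)\<^sup>2) = Q" if "span {Y, U} = span {V, Y}" for V
  proof -
    have "V \<in> span {Y, U}" using that span_base[of V "{V, Y}"] by simp
    then obtain b where "V - b *\<^sub>R Y \<in> span {U}" by (auto simp: span_insert)
    then obtain a where "V - b *\<^sub>R Y = a *\<^sub>R U" by (auto simp: span_singleton)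
    then have V: "V = a *\<^sub>R U + b *\<^sub>R Y" by (simp add: algebra_simps)
    \<comment> \<open>Otherwise \<open>V\<close> would be a multiple of \<open>Y\<close>, so
      \<open>U\<close> would lie on the line of \<open>Y\<close> and, being orthogonal to it,
      vanish.\<close>
    have "a \<noteq> 0"
    proof
      assume "a = 0"
      then have "{V, Y} \<subseteq> span {Y}" using V by (auto intro: span_scale span_base)
      then have "span {V, Y} \<subseteq> span {Y}" by (rule span_minimal) (rule subspace_span)
      then have "U \<in> span {Y}" using that span_base[of U "{Y, U}"] by auto
      then obtain t where t: "U = t *\<^sub>R Y" by (auto simp: span_singleton)
      then have "t = 0" using YU Y by (simp add: ip_simps)
      then show False using t U by (simp add: ip_simps)
    qed
    have "br (br V Y) Y = a *\<^sub>R br (br U Y) Y"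
    proof -
      have "br Y Y = 0" by (simp add: br_eq)
      then show ?thesis
        unfolding V by (simp add: bilinear_ladd[OF br_bilinear] bilinear_lmul[OF br_bilinear])
    qed
    then have "flag_operator A F p Y V = a *\<^sub>R Z"
      unfolding op chern_curvature_flag[OF Y0] Z_def by simp
    then show ?thesis
      unfolding F fundamental_tensor_norm_fun[OF Y0] Q_def
      using flag_quotient[OF Y U YU Z \<open>a \<noteq> 0\<close> V] by simp
  qed
  have "flag_curvature A F p (span {Y, U}) Y = Q"
    unfolding flag_curvature_def
  proof (rule the_equality)
    show "\<forall>V. span {Y, U} = span {V, Y} \<longrightarrow> Q = fundamental_tensor (F p) Y (flag_operator A F p Y V) V /
            (fundamental_tensor (F p) Y Y Y * fundamental_tensor (F p) Y V V
             - (fundamental_tensor (F p) Y Y V)\<^sup>2)"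
      using quot by simp
    fix k assume "\<forall>V. span {Y, U} = span {V, Y} \<longrightarrow> k = fundamental_tensor (F p) Y (flag_operator A F p Y V) V /
            (fundamental_tensor (F p) Y Y Y * fundamental_tensor (F p) Y V V
             - (fundamental_tensor (F p) Y Y V)\<^sup>2)"
    moreover have "span {Y, U} = span {U, Y}" by (simp add: insert_commute)
    ultimately show "k = Q" using quot[of U] by metis
  qed
  also have "Q = - (1 - ip Y X)\<^sup>2 / (4 * (1 - ip Y X) * (1 - 2 * ip Y X) + 8 * (ip U X)\<^sup>2) *
      (ip (br (br U Y) Y) U * (1 - ip Y X) * (1 - 2 * ip Y X)
       + 3 * ip (br (br U Y) Y) X * ip U X)"
  proof -
    define D where "D = (1 - ip Y X) * (1 - 2 * ip Y X) + 2 * (ip U X)\<^sup>2"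
    have 4: "4 * (1 - ip Y X) * (1 - 2 * ip Y X) + 8 * (ip U X)\<^sup>2 = 4 * D"
      by (simp add: D_def algebra_simps)
    \<comment> \<open>Brackets are orthogonal to the central vector \<open>X\<close>, so the last
      summand of the stated formula is zero. The factor -1/4 in \<open>Z\<close> supplies its sign
      and the 4 in front of \<open>D\<close>.\<close>
    have "ip (br (br U Y) Y) X = 0" using XB ip_sym by metis
    moreover have "ip Z U = - (1 / 4) * ip (br (br U Y) Y) U" by (simp add: Z_def ip_simps)
    ultimately show ?thesis
      unfolding Q_def 4 D_def[symmetric] by simp
  qed
  finally show ?thesis .
qed

end


section \<open>Bi-invariant metrics in a chart at the identity\<close>

lemma k_smooth_on_cong:
  assumes "open S" "k_smooth_on k f S" "\<And>x. x \<in> S \<Longrightarrow> f x = g x"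
  shows "k_smooth_on k g S"
  using assms(2,3)
proof (induction k arbitrary: f g)
  case 0
  then show ?case using continuous_on_cong[of S S f g] by simp
next
  case (Suc k)
  have "frechet_derivative f (at x) = frechet_derivative g (at x)" if "x \<in> S" for x
    by (rule frechet_derivative_cong_open[OF assms(1) that Suc.prems(2)])
  then have "k_smooth_on k (\<lambda>x. frechet_derivative g (at x) v) S" for v
    using Suc.IH[of "\<lambda>x. frechet_derivative f (at x) v" "\<lambda>x. frechet_derivative g (at x) v"] Suc.prems(1)
    by simp
  moreover have "g differentiable (at x)" if x: "x \<in> S" for x
  proof -
    have "f differentiable (at x)" using Suc.prems(1) x by simp
    then have "(g has_derivative frechet_derivative f (at x)) (at x)"
      by (intro has_derivative_transform_open[OF differentiable_derivD assms(1) x Suc.prems(2)])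
    then show ?thesis by (auto simp: differentiable_def)
  qed
  ultimately show ?case by simp
qed

text \<open>The derivative of a slice in the direction \<open>v\<close> is the slice of the
  derivative in the direction \<open>(v, 0)\<close>, so the induction stays among slices.\<close>

lemma k_smooth_on_slice:
  assumes "open S" "\<And>x. x \<in> S \<Longrightarrow> (x, c) \<in> W" "k_smooth_on k f W"
  shows "k_smooth_on k (\<lambda>x. f (x, c)) S"
  using assms(3)
proof (induction k arbitrary: f)
  case 0
  then have "continuous_on W f" by simp
  then have "continuous_on S (\<lambda>x. f (x, c))"
    by (rule continuous_on_compose2) (auto intro!: continuous_intros assms(2))
  then show ?case by simp
next
  case (Suc k)
  have D: "((\<lambda>x. f (x, c)) has_derivative (\<lambda>v. frechet_derivative f (at (x, c)) (v, 0))) (at x)"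
    if "x \<in> S" for x
  proof -
    have "f differentiable (at (x, c))" using Suc.prems assms(2)[OF that] by simp
    from has_derivative_compose[OF has_derivative_Pair[OF has_derivative_ident has_derivative_const] differentiable_derivD[OF this]]
    show ?thesis .
  qed
  have "k_smooth_on k (\<lambda>x. frechet_derivative f (at (x, c)) (v, 0)) S" for v
    using Suc.IH[of "\<lambda>p. frechet_derivative f (at p) (v, 0)"] Suc.prems by simp
  then have "k_smooth_on k (\<lambda>x. frechet_derivative (\<lambda>x. f (x, c)) (at x) v) S" for v
    by (rule k_smooth_on_cong[OF assms(1)]) (simp add: has_derivative_frechet_eq[OF D])
  moreover have "(\<lambda>x. f (x, c)) differentiable (at x)" if "x \<in> S" for x
    using D[OF that] by (auto simp: differentiable_def)
  ultimately show ?case by simp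
qed

text \<open>The Riemannian case of \<open>chern_equations_unique\<close>: with zero Cartan term the
  reference vector is arbitrary, and 0 is taken.\<close>

lemma levi_civita_symbol_eqI:
  assumes h: "bilinear (h x)" "\<And>v w. h x v w = h x w v" "\<And>v. v \<noteq> 0 \<Longrightarrow> h x v v > 0"
    and \<Gamma>: "bilinear \<Gamma>" "\<And>u v. \<Gamma> u v = \<Gamma> v u"
      "\<And>u v w. frechet_derivative (\<lambda>z. h z v w) (at x) u = h x (\<Gamma> u v) w + h x v (\<Gamma> u w)"
  shows "levi_civita_symbol h x = \<Gamma>"
  unfolding levi_civita_symbol_def
proof (rule the_equality)
  show "bilinear \<Gamma> \<and> (\<forall>u v. \<Gamma> u v = \<Gamma> v u) \<and>
      (\<forall>u v w. frechet_derivative (\<lambda>z. h z v w) (at x) u = h x (\<Gamma> u v) w + h x v (\<Gamma> u w))"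
    using \<Gamma> by blast
  fix \<Gamma>' assume \<Gamma>': "bilinear \<Gamma>' \<and> (\<forall>u v. \<Gamma>' u v = \<Gamma>' v u) \<and>
      (\<forall>u v w. frechet_derivative (\<lambda>z. h z v w) (at x) u = h x (\<Gamma>' u v) w + h x v (\<Gamma>' u w))"
  show "\<Gamma>' = \<Gamma>"
  proof (rule chern_equations_unique[where g="h x" and C="\<lambda>_ _ _. 0" and y=0
        and c="\<lambda>u v w. frechet_derivative (\<lambda>z. h z v w) (at x) u"])
    show "v = 0" if "\<And>w. h x v w = 0" for v using h(3)[of v] that[of v] by force
    show "linear (\<lambda>_. 0 :: real)" by (rule linearI) auto
    show "frechet_derivative (\<lambda>z. h z v w) (at x) u - 0 = h x (\<Gamma> u v) w + h x v (\<Gamma> u w)" for u v w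
      unfolding \<Gamma>(3) by simp
    show "frechet_derivative (\<lambda>z. h z v w) (at x) u - 0 = h x (\<Gamma>' u v) w + h x v (\<Gamma>' u w)" for u v w
      using \<Gamma>' by simp
  qed (use h(1,2) \<Gamma>(1,2) \<Gamma>' in blast)+
qed

lemma has_derivative_along_fst:
  assumes "(f has_derivative f') (at (x, y))"
  shows "((\<lambda>x. f (x, y)) has_derivative (\<lambda>u. f' (u, 0))) (at x)"
  by (rule has_derivative_compose[OF has_derivative_Pair[OF has_derivative_ident has_derivative_const] assms])

lemma has_derivative_along_snd:
  assumes "(f has_derivative f') (at (x, y))"
  shows "((\<lambda>y. f (x, y)) has_derivative (\<lambda>u. f' (0, u))) (at y)"
  by (rule has_derivative_compose[OF has_derivative_Pair[OF has_derivative_const has_derivative_ident] assms])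

text \<open>The group read in one chart around the identity. Products may leave the chart, so
  \<open>m\<close> is controlled on \<open>W\<close> only and associativity is asked for where all
  four products are defined. Invariance of \<open>h\<close> is stated through the partial
  derivatives of \<open>m\<close>, which are the differentials of the translations.\<close>

locale local_lie_group =
  fixes S :: "'e::euclidean_space set" and e0 :: 'e and W :: "('e \<times> 'e) set"
    and m :: "'e \<times> 'e \<Rightarrow> 'e" and h :: "'e \<Rightarrow> 'e \<Rightarrow> 'e \<Rightarrow> real"
  assumes S_open: "open S" and e0_in: "e0 \<in> S"
    and W_open: "open W" and W_subset: "W \<subseteq> S \<times> S"
    and m_smooth: "smooth_on m W" and m_in: "p \<in> W \<Longrightarrow> m p \<in> S"
    and right_unit: "x \<in> S \<Longrightarrow> (x, e0) \<in> W" "x \<in> S \<Longrightarrow> m (x, e0) = x"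
    and left_unit: "x \<in> S \<Longrightarrow> (e0, x) \<in> W" "x \<in> S \<Longrightarrow> m (e0, x) = x"
    and assoc: "(x, y) \<in> W \<Longrightarrow> (y, z) \<in> W \<Longrightarrow> (m (x, y), z) \<in> W \<Longrightarrow> (x, m (y, z)) \<in> W \<Longrightarrow>
      m (m (x, y), z) = m (x, m (y, z))"
    and h_bilinear: "x \<in> S \<Longrightarrow> bilinear (h x)"
    and h_sym: "x \<in> S \<Longrightarrow> h x u v = h x v u"
    and h_pos: "x \<in> S \<Longrightarrow> u \<noteq> 0 \<Longrightarrow> h x u u > 0"
    and h_differentiable: "x \<in> S \<Longrightarrow> (\<lambda>x. h x u v) differentiable (at x)"
    and h_left: "(x, y) \<in> W \<Longrightarrow>
      h (m (x, y)) (frechet_derivative m (at (x, y)) (0, u)) (frechet_derivative m (at (x, y)) (0, v)) = h y u v"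
    and h_right: "(x, y) \<in> W \<Longrightarrow>
      h (m (x, y)) (frechet_derivative m (at (x, y)) (u, 0)) (frechet_derivative m (at (x, y)) (v, 0)) = h x u v"
begin

definition E :: "'e \<Rightarrow> 'e \<Rightarrow> 'e" where
  "E x a = frechet_derivative m (at (x, e0)) (0, a)"

definition R :: "'e \<Rightarrow> 'e \<Rightarrow> 'e" where
  "R x a = frechet_derivative m (at (e0, x)) (a, 0)"

definition th :: "'e \<Rightarrow> 'e \<Rightarrow> 'e" where
  "th x = inv_into UNIV (E x)"

definition br :: "'e \<Rightarrow> 'e \<Rightarrow> 'e" where
  "br a b = coord_bracket (\<lambda>x. E x a) (\<lambda>x. E x b) e0"

lemmas m_has_derivative = smooth_on_has_derivative[OF m_smooth]

lemmas Dm_has_derivative = smooth_on_has_derivative[OF smooth_on_deriv[OF m_smooth]]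

lemma Dm_linear: "p \<in> W \<Longrightarrow> linear (frechet_derivative m (at p))"
  by (rule has_derivative_linear[OF m_has_derivative])

lemma Dm_snd_linear:
  assumes "p \<in> W"
  shows "linear (\<lambda>a. frechet_derivative m (at p) (0, a))"
proof -
  have "linear (\<lambda>a::'e. (0::'e, a))" by (auto intro!: linearI)
  from linear_compose[OF this Dm_linear[OF assms]] show ?thesis by (simp add: comp_def)
qed

lemma E_linear: "x \<in> S \<Longrightarrow> linear (E x)"
  unfolding E_def[abs_def] by (rule Dm_snd_linear[OF right_unit(1)])

lemma E_base: "E e0 a = a"
proof -
  have "((\<lambda>y. m (e0, y)) has_derivative E e0) (at e0)"
    unfolding E_def[abs_def] by (rule has_derivative_along_snd[OF m_has_derivative[OF left_unit(1)[OF e0_in]]])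
  moreover have "((\<lambda>y. m (e0, y)) has_derivative (\<lambda>a. a)) (at e0)"
    by (rule has_derivative_transform_open[OF has_derivative_ident S_open e0_in]) (simp add: left_unit)
  ultimately have "E e0 = (\<lambda>a. a)" by (rule has_derivative_unique)
  then show ?thesis by simp
qed

lemma R_base: "R e0 a = a"
proof -
  have "((\<lambda>x. m (x, e0)) has_derivative R e0) (at e0)"
    unfolding R_def[abs_def] by (rule has_derivative_along_fst[OF m_has_derivative[OF left_unit(1)[OF e0_in]]])
  moreover have "((\<lambda>x. m (x, e0)) has_derivative (\<lambda>a. a)) (at e0)"
    by (rule has_derivative_transform_open[OF has_derivative_ident S_open e0_in]) (simp add: right_unit)
  ultimately have "R e0 = (\<lambda>a. a)" by (rule has_derivative_unique)
  then show ?thesis by simp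
qed

lemma E_smooth: "smooth_on (\<lambda>x. E x a) S"
  unfolding smooth_on_def
proof
  fix k
  have "k_smooth_on k (\<lambda>p. frechet_derivative m (at p) (0, a)) W"
    using smooth_on_deriv[OF m_smooth] by (auto simp: smooth_on_def)
  then show "k_smooth_on k (\<lambda>x. E x a) S"
    unfolding E_def
    by (intro k_smooth_on_slice[where W=W and f="\<lambda>p. frechet_derivative m (at p) (0, a)"] S_open right_unit(1))
qed

lemma h_E: "x \<in> S \<Longrightarrow> h x (E x a) (E x b) = h e0 a b"
  using h_left[OF right_unit(1), of x a b] by (simp add: E_def right_unit)

lemma h_R: "x \<in> S \<Longrightarrow> h x (R x a) (R x b) = h e0 a b"
  using h_right[OF left_unit(1), of x a b] by (simp add: R_def left_unit)

lemma inner_form: "x \<in> S \<Longrightarrow> inner_form (h x)"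
  by unfold_locales (auto simp: h_bilinear h_sym h_pos)

text \<open>\<open>E x\<close> is an isometry from \<open>h e0\<close> to \<open>h x\<close>, hence
  injective, and the dimension is finite.\<close>

lemma E_bij:
  assumes "x \<in> S"
  shows "bij (E x)"
proof -
  have "a = 0" if "E x a = 0" for a
    using h_E[OF assms, of a a] h_pos[OF e0_in, of a] bilinear_lzero[OF h_bilinear[OF assms]] that by force
  then have "inj (E x)"
    using linear_injective_0[OF E_linear[OF assms]] by blast
  then show ?thesis
    using linear_injective_imp_surjective[OF E_linear[OF assms]] by (simp add: bij_def)
qed

lemma th_E: "x \<in> S \<Longrightarrow> th x (E x a) = a"
  using E_bij by (simp add: th_def bij_is_inj)

lemma E_th: "x \<in> S \<Longrightarrow> E x (th x v) = v"
  using E_bij by (simp add: th_def bij_is_surj surj_f_inv_f)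

lemma h_th: "x \<in> S \<Longrightarrow> h e0 a (th x v) = h x (E x a) v"
  using h_E[of x a "th x v"] by (simp add: E_th)

lemma h_differentiable_apply:
  assumes x: "x \<in> S" and f: "(f has_derivative f') (at x)"
  shows "((\<lambda>z. h z (f z) v) has_derivative
    (\<lambda>u. frechet_derivative (\<lambda>z. h z (f x) v) (at x) u + h x (f' u) v)) (at x)"
  by (rule has_derivative_linear_apply[where f="\<lambda>z a. h z a v" and S=S
        and f'="\<lambda>a. frechet_derivative (\<lambda>z. h z a v) (at x)"])
    (use x f S_open h_bilinear differentiable_derivD[OF h_differentiable[OF x]] in \<open>auto simp: bilinear_def\<close>)

text \<open>Smoothness of the metric gives that of the inverse frame: \<open>th x v\<close> is the vector
  representing \<open>a \<mapsto> h x (E x a) v\<close> with respect to \<open>h e0\<close>.\<close>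

lemma th_differentiable:
  assumes x: "x \<in> S"
  shows "(\<lambda>x. th x v) differentiable (at x)"
proof -
  interpret ip: inner_form "h e0" by (rule inner_form[OF e0_in])
  \<comment> \<open>\<open>\<Phi>\<close> lists the products with the basis vectors. A fixed linear
    left inverse recovers \<open>th z v\<close> from the numbers \<open>h z (E z i) v\<close>, which
    depend differentiably on \<open>z\<close>.\<close>
  define \<Phi> where "\<Phi> u = (\<Sum>i\<in>Basis. h e0 i u *\<^sub>R i)" for u :: 'e
  have \<Phi>: "linear \<Phi>"
    unfolding \<Phi>_def by (auto intro!: linearI simp: ip.ip_simps sum.distrib scaleR_add_left scaleR_sum_right)
  have "u = 0" if "\<Phi> u = 0" for u
  proof -
    have "h e0 i u = 0" if "i \<in> Basis" for i
    proof -
      have "h e0 i u = \<Phi> u \<bullet> i"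
        unfolding \<Phi>_def using that by (simp add: inner_sum_left inner_Basis if_distrib cong: if_cong)
      then show ?thesis using \<open>\<Phi> u = 0\<close> by simp
    qed
    moreover have "linear (\<lambda>a. h e0 a u)" using h_bilinear[OF e0_in] by (simp add: bilinear_def)
    ultimately have "h e0 a u = 0" for a
      using linear_expand_Basis[of "\<lambda>a. h e0 a u" a] by simp
    then show ?thesis using ip.ip_nondegenerate[of u] h_sym[OF e0_in] by metis
  qed
  then have "inj \<Phi>" using linear_injective_0[OF \<Phi>] by blast
  then obtain \<Psi> where \<Psi>: "linear \<Psi>" "\<Psi> \<circ> \<Phi> = id"
    using linear_injective_left_inverse[OF \<Phi>] by blast
  have eq: "th z v = \<Psi> (\<Sum>i\<in>Basis. h z (E z i) v *\<^sub>R i)" if "z \<in> S" for z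
  proof -
    have "th z v = \<Psi> (\<Phi> (th z v))" using \<Psi>(2) by (metis comp_apply id_apply)
    then show ?thesis unfolding \<Phi>_def by (simp add: h_th[OF that])
  qed
  have d: "((\<lambda>z. h z (E z i) v) has_derivative
      (\<lambda>u. frechet_derivative (\<lambda>z. h z (E x i) v) (at x) u + h x (frechet_derivative (\<lambda>z. E z i) (at x) u) v)) (at x)" for i
    by (rule h_differentiable_apply[OF x smooth_on_has_derivative[OF E_smooth x]])
  have "((\<lambda>z. \<Sum>i\<in>Basis. h z (E z i) v *\<^sub>R i) has_derivative
     (\<lambda>u. \<Sum>i\<in>Basis. (frechet_derivative (\<lambda>z. h z (E x i) v) (at x) u + h x (frechet_derivative (\<lambda>z. E z i) (at x) u) v) *\<^sub>R i)) (at x)"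
    by (intro has_derivative_sum has_derivative_scaleR_left d)
  moreover have "(\<Psi> has_derivative \<Psi>) (at y)" for y
    using \<Psi>(1) linear_imp_has_derivative by blast
  ultimately have "((\<lambda>z. \<Psi> (\<Sum>i\<in>Basis. h z (E z i) v *\<^sub>R i)) has_derivative
     (\<lambda>u. \<Psi> (\<Sum>i\<in>Basis. (frechet_derivative (\<lambda>z. h z (E x i) v) (at x) u + h x (frechet_derivative (\<lambda>z. E z i) (at x) u) v) *\<^sub>R i))) (at x)"
    by (rule has_derivative_compose)
  then show ?thesis
    unfolding differentiable_def
    by (intro exI, rule has_derivative_transform_open[OF _ S_open x]) (rule eq[symmetric])
qed

lemma open_slice: "open {y. (x, y) \<in> W}"
proof -
  have "open ((\<lambda>y. (x, y)) -` W)"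
    by (rule open_vimage[OF W_open]) (intro continuous_intros)
  then show ?thesis by (simp add: vimage_def)
qed

text \<open>Associativity, differentiated in the last factor.\<close>

lemma E_m:
  assumes xy: "(x, y) \<in> W"
  shows "E (m (x, y)) a = frechet_derivative m (at (x, y)) (0, E y a)"
proof -
  have S: "x \<in> S" "y \<in> S" "m (x, y) \<in> S" using xy W_subset m_in by auto
  \<comment> \<open>\<open>B\<close> and \<open>N\<close> collect the conditions on \<open>z\<close>
    under which associativity applies to \<open>x\<close>, \<open>y\<close>, \<open>z\<close>. The
    set \<open>N\<close> is open and contains \<open>e0\<close>, so the two triple products have the
    same derivative there.\<close>
  define B where "B = {z. (y, z) \<in> W} \<inter> {z. (m (x, y), z) \<in> W}"
  define N where "N = B \<inter> (\<lambda>z. m (y, z)) -` {w. (x, w) \<in> W}"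
  have "continuous_on B (\<lambda>z. m (y, z))"
    by (rule continuous_on_compose2[OF smooth_on_continuous[OF m_smooth]])
      (auto intro!: continuous_intros simp: B_def)
  moreover have "open B"
    unfolding B_def by (intro open_Int open_slice)
  ultimately have "open N"
    unfolding N_def by (rule continuous_open_preimage) (rule open_slice)
  have e0N: "e0 \<in> N" unfolding N_def B_def using right_unit S xy by auto
  have "((\<lambda>z. m (m (x, y), z)) has_derivative E (m (x, y))) (at e0)"
    unfolding E_def[abs_def] by (rule has_derivative_along_snd[OF m_has_derivative[OF right_unit(1)[OF S(3)]]])
  then have 1: "((\<lambda>z. m (x, m (y, z))) has_derivative E (m (x, y))) (at e0)"
    by (rule has_derivative_transform_open[OF _ \<open>open N\<close> e0N]) (use xy assoc in \<open>auto simp: N_def B_def\<close>)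
  have 2: "((\<lambda>z. m (y, z)) has_derivative E y) (at e0)"
    unfolding E_def[abs_def] by (rule has_derivative_along_snd[OF m_has_derivative[OF right_unit(1)[OF S(2)]]])
  have "((\<lambda>w. m (x, w)) has_derivative (\<lambda>u. frechet_derivative m (at (x, y)) (0, u))) (at (m (y, e0)))"
    using has_derivative_along_snd[OF m_has_derivative[OF xy]] right_unit S by simp
  from has_derivative_compose[OF 2 this]
  have "((\<lambda>z. m (x, m (y, z))) has_derivative (\<lambda>u. frechet_derivative m (at (x, y)) (0, E y u))) (at e0)" .
  from has_derivative_unique[OF 1 this] show ?thesis by simp
qed

lemma E_has_derivative: "x \<in> S \<Longrightarrow>
    ((\<lambda>z. E z a) has_derivative frechet_derivative (\<lambda>z. E z a) (at x)) (at x)"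
  by (rule smooth_on_has_derivative[OF E_smooth])

text \<open>Identity \<open>E_m\<close>, differentiated at \<open>y = e0\<close>. The second derivative of \<open>m\<close> is symmetric and
  drops out of the bracket.\<close>

lemma E_derivative:
  assumes x: "x \<in> S"
  shows "frechet_derivative (\<lambda>z. E z a) (at x) (E x b) =
    frechet_derivative (\<lambda>p. frechet_derivative m (at p) (0, a)) (at (x, e0)) (0, b)
    + E x (frechet_derivative (\<lambda>z. E z a) (at e0) b)"
proof -
  have m': "((\<lambda>y. m (x, y)) has_derivative E x) (at e0)"
    unfolding E_def[abs_def] by (rule has_derivative_along_snd[OF m_has_derivative[OF right_unit(1)[OF x]]])
  have "((\<lambda>z. E z a) has_derivative frechet_derivative (\<lambda>z. E z a) (at x)) (at (m (x, e0)))"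
    using E_has_derivative[OF x] by (simp add: right_unit(2)[OF x])
  from has_derivative_compose[OF m' this]
  have 1: "((\<lambda>y. E (m (x, y)) a) has_derivative (\<lambda>b. frechet_derivative (\<lambda>z. E z a) (at x) (E x b))) (at e0)" .
  have "((\<lambda>y. frechet_derivative m (at (x, y)) (0, E y a)) has_derivative
      (\<lambda>b. frechet_derivative (\<lambda>p. frechet_derivative m (at p) (0, E e0 a)) (at (x, e0)) (0, b)
        + frechet_derivative m (at (x, e0)) (0, frechet_derivative (\<lambda>z. E z a) (at e0) b))) (at e0)"
    by (rule has_derivative_linear_apply[where f="\<lambda>y v. frechet_derivative m (at (x, y)) (0, v)"
          and f'="\<lambda>v b. frechet_derivative (\<lambda>p. frechet_derivative m (at p) (0, v)) (at (x, e0)) (0, b)"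
          and g="\<lambda>y. E y a" and S="{y. (x, y) \<in> W}"])
      (use x right_unit E_has_derivative[OF e0_in] open_slice Dm_snd_linear
        in \<open>auto intro!: has_derivative_along_snd Dm_has_derivative\<close>)
  then have 2: "((\<lambda>y. E (m (x, y)) a) has_derivative
      (\<lambda>b. frechet_derivative (\<lambda>p. frechet_derivative m (at p) (0, E e0 a)) (at (x, e0)) (0, b)
        + frechet_derivative m (at (x, e0)) (0, frechet_derivative (\<lambda>z. E z a) (at e0) b))) (at e0)"
    by (rule has_derivative_transform_open[OF _ open_slice[of x]])
      (use x right_unit E_m in auto)
  from fun_cong[OF has_derivative_unique[OF 1 2], of b] show ?thesis
    by (simp only: E_base E_def[of x])
qed

lemma br_eq: "br a b = frechet_derivative (\<lambda>z. E z b) (at e0) a - frechet_derivative (\<lambda>z. E z a) (at e0) b"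
  by (simp add: br_def coord_bracket_def E_base)

lemma frame_bracket:
  assumes x: "x \<in> S"
  shows "coord_bracket (\<lambda>z. E z a) (\<lambda>z. E z b) x = E x (br a b)"
proof -
  have "frechet_derivative (\<lambda>p. frechet_derivative m (at p) (0, a)) (at (x, e0)) (0, b) =
      frechet_derivative (\<lambda>p. frechet_derivative m (at p) (0, b)) (at (x, e0)) (0, a)"
    by (rule smooth_on_symmetric_second_derivative[OF m_smooth W_open right_unit(1)[OF x]])
  then show ?thesis
    unfolding coord_bracket_def E_derivative[OF x] br_eq linear_diff[OF E_linear[OF x]] by simp
qed

text \<open>Both sides are the mixed second derivative of \<open>m\<close> at
  \<open>(e0, e0)\<close> in the directions \<open>(a, 0)\<close> and \<open>(0, c)\<close>. Thus
  the two frames have the same first derivatives at \<open>e0\<close> with the two vectors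
  interchanged.\<close>

lemma R_has_derivative:
  "((\<lambda>z. R z a) has_derivative (\<lambda>c. frechet_derivative (\<lambda>z. E z c) (at e0) a)) (at e0)"
proof -
  have ee: "(e0, e0) \<in> W" using right_unit(1)[OF e0_in] .
  have "((\<lambda>z. R z a) has_derivative
      (\<lambda>c. frechet_derivative (\<lambda>p. frechet_derivative m (at p) (a, 0)) (at (e0, e0)) (0, c))) (at e0)"
    unfolding R_def by (rule has_derivative_along_snd[OF Dm_has_derivative[OF ee]])
  moreover have "frechet_derivative (\<lambda>p. frechet_derivative m (at p) (a, 0)) (at (e0, e0)) (0, c) =
      frechet_derivative (\<lambda>z. E z c) (at e0) a" for c
  proof -
    have "((\<lambda>z. E z c) has_derivative
      (\<lambda>a. frechet_derivative (\<lambda>p. frechet_derivative m (at p) (0, c)) (at (e0, e0)) (a, 0))) (at e0)"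
      unfolding E_def by (rule has_derivative_along_fst[OF Dm_has_derivative[OF ee]])
    then show ?thesis
      using smooth_on_symmetric_second_derivative[OF m_smooth W_open ee] has_derivative_frechet_eq by metis
  qed
  ultimately show ?thesis by simp
qed

text \<open>The constant function \<open>h z (F z a) (F z b)\<close> is differentiated at
  \<open>e0\<close>. The frame is kept general so that the left and the right invariant one can both
  be inserted.\<close>

lemma isometric_frame_derivative:
  assumes F: "\<And>a. F e0 a = a" "\<And>a. ((\<lambda>z. F z a) has_derivative F' a) (at e0)"
    and iso: "\<And>x a b. x \<in> S \<Longrightarrow> h x (F x a) (F x b) = h e0 a b"
  shows "frechet_derivative (\<lambda>z. h z a b) (at e0) c + h e0 (F' a c) b + h e0 a (F' b c) = 0"
proof -
  have 1: "((\<lambda>z. h z (F z a) v) has_derivative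
    (\<lambda>u. frechet_derivative (\<lambda>z. h z a v) (at e0) u + h e0 (F' a u) v)) (at e0)" for v
    using h_differentiable_apply[OF e0_in F(2), of a v] by (simp add: F(1))
  have "((\<lambda>z. h z (F z a) (F z b)) has_derivative
    (\<lambda>u. (frechet_derivative (\<lambda>z. h z a (F e0 b)) (at e0) u + h e0 (F' a u) (F e0 b)) + h e0 (F e0 a) (F' b u))) (at e0)"
    by (rule has_derivative_linear_apply[where f="\<lambda>z v. h z (F z a) v" and S=S
          and f'="\<lambda>v u. frechet_derivative (\<lambda>z. h z a v) (at e0) u + h e0 (F' a u) v"])
      (use 1 F S_open e0_in h_bilinear in \<open>auto simp: bilinear_def\<close>)
  moreover have "((\<lambda>z. h z (F z a) (F z b)) has_derivative (\<lambda>u. 0)) (at e0)"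
    by (rule has_derivative_transform_open[OF has_derivative_const[of "h e0 a b"] S_open e0_in]) (simp add: iso)
  ultimately have "(\<lambda>u. (frechet_derivative (\<lambda>z. h z a (F e0 b)) (at e0) u + h e0 (F' a u) (F e0 b)) + h e0 (F e0 a) (F' b u)) = (\<lambda>u. 0)"
    by (rule has_derivative_unique)
  from fun_cong[OF this, of c] show ?thesis by (simp only: F(1))
qed

lemma h_derivative_E:
  "frechet_derivative (\<lambda>z. h z a b) (at e0) c
    + h e0 (frechet_derivative (\<lambda>z. E z a) (at e0) c) b
    + h e0 a (frechet_derivative (\<lambda>z. E z b) (at e0) c) = 0"
  by (rule isometric_frame_derivative[where F=E, OF E_base E_has_derivative[OF e0_in] h_E])

lemma h_derivative_R:
  "frechet_derivative (\<lambda>z. h z a b) (at e0) c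
    + h e0 (frechet_derivative (\<lambda>z. E z c) (at e0) a) b
    + h e0 a (frechet_derivative (\<lambda>z. E z c) (at e0) b) = 0"
  by (rule isometric_frame_derivative[where F=R, OF R_base R_has_derivative h_R])

text \<open>Subtracting \<open>h_derivative_R\<close> from \<open>h_derivative_E\<close> eliminates
  the derivative of \<open>h\<close>, and the differences of frame derivatives that remain are
  \<open>br c a\<close> and \<open>br c b\<close>.\<close>

lemma ad_invariant: "h e0 (br c a) b + h e0 a (br c b) = 0"
  unfolding br_eq
  using h_derivative_E[of a b c] h_derivative_R[of a b c]
  by (simp add: bilinear_lsub[OF h_bilinear[OF e0_in]] bilinear_rsub[OF h_bilinear[OF e0_in]])

lemma dE_linear: "linear (\<lambda>a. frechet_derivative (\<lambda>z. E z a) (at e0) c)"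
proof (rule linearI)
  fix a b :: 'e and r :: real
  have "((\<lambda>z. E z (a + b)) has_derivative
      (\<lambda>u. frechet_derivative (\<lambda>z. E z a) (at e0) u + frechet_derivative (\<lambda>z. E z b) (at e0) u)) (at e0)"
    by (rule has_derivative_transform_open
        [OF has_derivative_add[OF E_has_derivative[OF e0_in] E_has_derivative[OF e0_in]] S_open e0_in])
      (simp add: linear_add[OF E_linear])
  from has_derivative_frechet_eq[OF this]
  show "frechet_derivative (\<lambda>z. E z (a + b)) (at e0) c =
      frechet_derivative (\<lambda>z. E z a) (at e0) c + frechet_derivative (\<lambda>z. E z b) (at e0) c" by simp
  have "((\<lambda>z. E z (r *\<^sub>R a)) has_derivative
      (\<lambda>u. r *\<^sub>R frechet_derivative (\<lambda>z. E z a) (at e0) u)) (at e0)"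
    by (rule has_derivative_transform_open
        [OF has_derivative_scaleR_right[OF E_has_derivative[OF e0_in]] S_open e0_in])
      (simp add: linear_scale[OF E_linear])
  from has_derivative_frechet_eq[OF this]
  show "frechet_derivative (\<lambda>z. E z (r *\<^sub>R a)) (at e0) c =
      r *\<^sub>R frechet_derivative (\<lambda>z. E z a) (at e0) c" by simp
qed

text \<open>In the frame the connection is half the bracket; the second term converts it to
  coordinates. For metric compatibility the half brackets cancel by skewness, and the frame
  derivatives account for the derivative of \<open>h\<close>. Symmetry holds because the skew part
  of the second term is the bracket.\<close>

lemma levi_civita_symbol_base:
  "levi_civita_symbol h e0 u v = (1 / 2) *\<^sub>R br u v - frechet_derivative (\<lambda>z. E z v) (at e0) u"
proof -
  define \<Gamma> where "\<Gamma> u v = (1 / 2) *\<^sub>R br u v - frechet_derivative (\<lambda>z. E z v) (at e0) u" for u v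
  note lin = linear_add[OF dE_linear] linear_scale[OF dE_linear]
    linear_add[OF has_derivative_linear[OF E_has_derivative[OF e0_in]]]
    linear_scale[OF has_derivative_linear[OF E_has_derivative[OF e0_in]]]
  note bil = bilinear_lsub[OF h_bilinear[OF e0_in]] bilinear_rsub[OF h_bilinear[OF e0_in]]
    bilinear_lmul[OF h_bilinear[OF e0_in]] bilinear_rmul[OF h_bilinear[OF e0_in]]
  have half: "p = (1 / 2) *\<^sub>R p + (1 / 2) *\<^sub>R p" for p :: 'e
    by (simp flip: scaleR_add_left)
  have "levi_civita_symbol h e0 = \<Gamma>"
  proof (rule levi_civita_symbol_eqI)
    show "bilinear \<Gamma>"
      unfolding bilinear_def \<Gamma>_def br_eq by (auto intro!: linearI simp: lin algebra_simps)
    show "\<Gamma> u v = \<Gamma> v u" for u v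
      unfolding \<Gamma>_def br_eq
      using half[of "frechet_derivative (\<lambda>z. E z v) (at e0) u"] half[of "frechet_derivative (\<lambda>z. E z u) (at e0) v"]
      by (simp add: algebra_simps)
    show "frechet_derivative (\<lambda>z. h z v w) (at e0) u = h e0 (\<Gamma> u v) w + h e0 v (\<Gamma> u w)" for u v w
      unfolding \<Gamma>_def bil using h_derivative_E[of v w u] ad_invariant[of u v w] by simp
  qed (use h_bilinear h_sym h_pos e0_in in auto)
  then show ?thesis by (simp add: \<Gamma>_def)
qed

text \<open>Parallelism at \<open>e0\<close> already makes \<open>X\<close> central: the derivative
  of the frame field cancels against the second term of the symbol and leaves half of
  \<open>br c X\<close>.\<close>

lemma invariant_frameI:
  assumes small: "sqrt (h e0 X X) < 1 / 2"
    and parallel: "\<And>v. frechet_derivative (\<lambda>z. E z X) (at e0) v + levi_civita_symbol h e0 v X = 0"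
    and L: "\<And>x y. x \<in> S \<Longrightarrow> L x y = h x y y / (sqrt (h x y y) - h x (E x X) y)"
  shows "invariant_frame (h e0) X S e0 E th br L"
proof -
  interpret N: matsumoto_norm "h e0" X
    using inner_form[OF e0_in] small by (simp add: matsumoto_norm_def matsumoto_norm_axioms_def)
  show ?thesis
  proof (intro invariant_frame.intro invariant_frame_axioms.intro)
    show "matsumoto_norm (h e0) X" by (rule N.matsumoto_norm_axioms)
    show "br c X = 0" for c
      using parallel[of c] by (simp add: levi_civita_symbol_base)
    show "L x y = N.norm_fun (th x y)" if "x \<in> S" for x y
    proof -
      \<comment> \<open>\<open>th x\<close> is an isometry taking the field value
        \<open>E x X\<close> to \<open>X\<close>, so \<alpha> and \<beta> at \<open>(x, y)\<close>
        equal their values at \<open>th x y\<close> over the identity.\<close>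
      have "h e0 (th x y) (th x y) = h x y y" using h_th[OF that, of "th x y" y] by (simp add: E_th[OF that])
      then show ?thesis
        unfolding N.norm_fun_def N.den_def N.rad_sq by (simp add: L[OF that] N.rad_def h_th[OF that])
    qed
  qed (fact S_open e0_in E_linear E_base th_E E_th E_smooth th_differentiable frame_bracket ad_invariant)+
qed

end


section \<open>Charts and translations of a Lie group\<close>

text \<open>Each point of \<open>V\<close> has a product neighbourhood inside \<open>V\<close>, and
  its image is a product of open sets. This makes the coordinate domain of the multiplication
  open.\<close>

lemma open_map_prod_image:
  assumes V: "openin (prod_topology T T') V" "V \<subseteq> A \<times> B"
    and f: "\<And>Q. openin T Q \<Longrightarrow> Q \<subseteq> A \<Longrightarrow> open (f ` Q)" and A: "openin T A"
    and g: "\<And>Q. openin T' Q \<Longrightarrow> Q \<subseteq> B \<Longrightarrow> open (g ` Q)" and B: "openin T' B"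
  shows "open (map_prod f g ` V)"
  unfolding open_prod_def
proof
  fix w assume "w \<in> map_prod f g ` V"
  then obtain p q where w: "w = map_prod f g (p, q)" "(p, q) \<in> V" by auto
  have "\<exists>Q Q'. openin T Q \<and> openin T' Q' \<and> p \<in> Q \<and> q \<in> Q' \<and> Q \<times> Q' \<subseteq> V"
    using V(1) w(2) unfolding openin_prod_topology_alt by simp
  then obtain Q Q' where Q: "openin T Q" "openin T' Q'" "p \<in> Q" "q \<in> Q'" "Q \<times> Q' \<subseteq> V"
    by blast
  have "open (f ` (Q \<inter> A))" "open (g ` (Q' \<inter> B))"
    using f[of "Q \<inter> A"] g[of "Q' \<inter> B"] Q A B by auto
  moreover have "w \<in> f ` (Q \<inter> A) \<times> g ` (Q' \<inter> B)"
    using Q V(2) w by auto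
  moreover have "f ` (Q \<inter> A) \<times> g ` (Q' \<inter> B) \<subseteq> map_prod f g ` V"
    using Q(5) by (force simp: image_iff)
  ultimately show "\<exists>A B. open A \<and> open B \<and> w \<in> A \<times> B \<and> A \<times> B \<subseteq> map_prod f g ` V"
    by (intro exI conjI)
qed

locale manifold =
  fixes T :: "'m topology" and A :: "('m, 'e::euclidean_space) chart set"
  assumes smooth_manifold: "smooth_manifold T A"
begin

lemma chart_openin: "c \<in> A \<Longrightarrow> openin T (fst c)"
  using smooth_manifold by (simp add: smooth_manifold_def)

lemma chart_image_open: "c \<in> A \<Longrightarrow> open (chart_image c)"
  using smooth_manifold by (simp add: smooth_manifold_def)

lemma chart_homeomorphic:
  "c \<in> A \<Longrightarrow> homeomorphic_map (subtopology T (fst c)) (top_of_set (chart_image c)) (snd c)"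
  using smooth_manifold by (simp add: smooth_manifold_def)

lemma chart_subset: "c \<in> A \<Longrightarrow> fst c \<subseteq> topspace T"
  using chart_openin openin_subset by blast

lemma chart_inj: "c \<in> A \<Longrightarrow> inj_on (snd c) (fst c)"
  using homeomorphic_imp_injective_map[OF chart_homeomorphic] chart_subset
  by (simp add: topspace_subtopology Int_absorb1)

lemma chart_image_subset_open:
  assumes "c \<in> A" "openin T V" "V \<subseteq> fst c"
  shows "open (snd c ` V)"
proof -
  have "openin (subtopology T (fst c)) V"
    using assms by (auto simp: openin_subtopology)
  then have "openin (top_of_set (chart_image c)) (snd c ` V)"
    using homeomorphic_imp_open_map[OF chart_homeomorphic[OF assms(1)]] by (simp add: open_map_def)
  then show ?thesis
    using chart_image_open[OF assms(1)] openin_open_trans by blast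
qed

lemma chart_inv_chart: "c \<in> A \<Longrightarrow> p \<in> fst c \<Longrightarrow> chart_inv c (snd c p) = p"
  using chart_inj by (simp add: inv_into_f_f)

lemma chart_at_in: 
  assumes "p \<in> topspace T"
  shows "chart_at A p \<in> A" "p \<in> fst (chart_at A p)"
proof -
  have "p \<in> (\<Union>c\<in>A. fst c)"
    using assms smooth_manifold by (simp add: smooth_manifold_def)
  then have "\<exists>c. c \<in> A \<and> p \<in> fst c" by blast
  from someI_ex[OF this] show "chart_at A p \<in> A" "p \<in> fst (chart_at A p)"
    by (simp_all add: chart_at_def)
qed

text \<open>Besides differentiability in all charts, the definition asks that \<open>f\<close> map a
  neighbourhood of \<open>p\<close> into each target chart around \<open>f p\<close>; otherwise
  coordinate expressions of composites could involve values outside the chart, where its map is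
  arbitrary.\<close>

definition chart_differentiable :: "('m \<Rightarrow> 'm) \<Rightarrow> 'm \<Rightarrow> bool" where
  "chart_differentiable f p \<longleftrightarrow> p \<in> topspace T \<and> f p \<in> topspace T \<and>
     (\<forall>d\<in>A. f p \<in> fst d \<longrightarrow> (\<exists>V. openin T V \<and> p \<in> V \<and> f ` V \<subseteq> fst d)) \<and>
     (\<forall>c\<in>A. \<forall>d\<in>A. p \<in> fst c \<longrightarrow> f p \<in> fst d \<longrightarrow>
        (snd d \<circ> f \<circ> chart_inv c) differentiable (at (snd c p)))"

definition coord_deriv :: "('m, 'e) chart \<Rightarrow> ('m, 'e) chart \<Rightarrow> ('m \<Rightarrow> 'm) \<Rightarrow> 'm \<Rightarrow> 'e \<Rightarrow> 'e" where
  "coord_deriv c d f p = frechet_derivative (snd d \<circ> f \<circ> chart_inv c) (at (snd c p))"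

lemma coord_deriv_linear:
  assumes "chart_differentiable f p" "c \<in> A" "d \<in> A" "p \<in> fst c" "f p \<in> fst d"
  shows "linear (coord_deriv c d f p)"
  unfolding coord_deriv_def
  by (rule linear_frechet_derivative) (use assms in \<open>auto simp: chart_differentiable_def\<close>)

lemma chart_differentiable_id:
  assumes "p \<in> topspace T"
  shows "chart_differentiable id p"
  unfolding chart_differentiable_def
proof (intro conjI ballI impI)
  fix d assume "d \<in> A" "id p \<in> fst d"
  then show "\<exists>V. openin T V \<and> p \<in> V \<and> id ` V \<subseteq> fst d"
    using chart_openin by (intro exI[of _ "fst d"]) auto
next
  fix c d assume c: "c \<in> A" "p \<in> fst c" and d: "d \<in> A" "id p \<in> fst d"
  have "smooth_on (snd d \<circ> chart_inv c) (snd c ` (fst c \<inter> fst d))"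
    using smooth_manifold c(1) d(1) by (simp add: smooth_manifold_def)
  from smooth_on_differentiable[OF this] c d
  show "(snd d \<circ> id \<circ> chart_inv c) differentiable (at (snd c p))" by auto
qed (use assms in auto)

text \<open>The chain rule through the intermediate chart \<open>d\<close>. The two coordinate
  expressions agree on \<open>Q\<close>, the part of the chart \<open>c\<close> that
  \<open>f\<close> is known to send into \<open>d\<close>.\<close>

lemma coord_deriv_comp:
  assumes f: "chart_differentiable f p" and g: "chart_differentiable g (f p)"
    and c: "c \<in> A" "p \<in> fst c" and d: "d \<in> A" "f p \<in> fst d" and e: "e \<in> A" "g (f p) \<in> fst e"
  shows "coord_deriv c e (g \<circ> f) p = coord_deriv d e g (f p) \<circ> coord_deriv c d f p"
proof -
  obtain V where V: "openin T V" "p \<in> V" "f ` V \<subseteq> fst d"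
    using f d unfolding chart_differentiable_def by blast
  define Q where "Q = snd c ` (fst c \<inter> V)"
  have "open Q"
    unfolding Q_def by (rule chart_image_subset_open[OF c(1)]) (use V chart_openin[OF c(1)] in auto)
  have Q: "snd c p \<in> Q" unfolding Q_def using V c by auto
  have 1: "((snd d \<circ> f \<circ> chart_inv c) has_derivative coord_deriv c d f p) (at (snd c p))"
    unfolding coord_deriv_def
    by (rule differentiable_derivD) (use f c d in \<open>auto simp: chart_differentiable_def\<close>)
  have "((snd e \<circ> g \<circ> chart_inv d) has_derivative coord_deriv d e g (f p)) (at (snd d (f p)))"
    unfolding coord_deriv_def
    by (rule differentiable_derivD) (use g d e in \<open>auto simp: chart_differentiable_def\<close>)
  then have 2: "((snd e \<circ> g \<circ> chart_inv d) has_derivative coord_deriv d e g (f p)) (at ((snd d \<circ> f \<circ> chart_inv c) (snd c p)))"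
    using chart_inv_chart[OF c] by simp
  have "((snd e \<circ> (g \<circ> f) \<circ> chart_inv c) has_derivative coord_deriv d e g (f p) \<circ> coord_deriv c d f p) (at (snd c p))"
  proof (rule has_derivative_transform_open[OF _ \<open>open Q\<close> Q])
    show "((snd e \<circ> g \<circ> chart_inv d) \<circ> (snd d \<circ> f \<circ> chart_inv c) has_derivative
        coord_deriv d e g (f p) \<circ> coord_deriv c d f p) (at (snd c p))"
      using has_derivative_compose[OF 1 2] by (simp add: comp_def)
    fix x assume "x \<in> Q"
    then obtain q where q: "x = snd c q" "q \<in> fst c" "q \<in> V" by (auto simp: Q_def)
    then show "((snd e \<circ> g \<circ> chart_inv d) \<circ> (snd d \<circ> f \<circ> chart_inv c)) x = (snd e \<circ> (g \<circ> f) \<circ> chart_inv c) x"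
      using chart_inv_chart[OF c(1)] chart_inv_chart[OF d(1)] V(3) by auto
  qed
  then show ?thesis
    unfolding coord_deriv_def[of c e] by (rule has_derivative_frechet_eq)
qed

lemma coord_deriv_id:
  assumes "c \<in> A" "p \<in> fst c"
  shows "coord_deriv c c id p = id"
proof -
  have "((snd c \<circ> id \<circ> chart_inv c) has_derivative id) (at (snd c p))"
  proof (rule has_derivative_transform_open[OF _ chart_image_open[OF assms(1)]])
    show "(id has_derivative id) (at (snd c p))" by (simp add: id_def)
    show "id x = (snd c \<circ> id \<circ> chart_inv c) x" if "x \<in> chart_image c" for x
      using that by (simp add: f_inv_into_f)
  qed (use assms in auto)
  then show ?thesis unfolding coord_deriv_def by (rule has_derivative_frechet_eq)
qed

text \<open>This and the next two equations turn tangent maps and changes of representation into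
  Jacobians, so that \<open>coord_deriv_comp\<close> handles all of them.\<close>

lemma tangent_map_eq: "tangent_map A A f p = coord_deriv (chart_at A p) (chart_at A (f p)) f p"
  by (simp add: tangent_map_def coord_deriv_def)

lemma to_chart_eq: "to_chart A c p = coord_deriv (chart_at A p) c id p"
  by (simp add: to_chart_def coord_deriv_def)

lemma from_chart_eq: "from_chart A c p = coord_deriv c (chart_at A p) id p"
  by (simp add: from_chart_def coord_deriv_def)

lemma to_chart_from_chart:
  assumes "c \<in> A" "p \<in> fst c"
  shows "to_chart A c p (from_chart A c p v) = v"
    and "from_chart A c p (to_chart A c p v) = v"
proof -
  have p: "p \<in> topspace T" using assms chart_subset by blast
  note [simp] = chart_differentiable_id[OF p] chart_at_in[OF p] assms
  have "to_chart A c p \<circ> from_chart A c p = id"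
    unfolding to_chart_eq from_chart_eq
    using coord_deriv_comp[of id p id c "chart_at A p" c] coord_deriv_id[of c p] by simp
  then show "to_chart A c p (from_chart A c p v) = v" by (metis comp_apply id_apply)
  have "from_chart A c p \<circ> to_chart A c p = id"
    unfolding to_chart_eq from_chart_eq
    using coord_deriv_comp[of id p id "chart_at A p" c "chart_at A p"] coord_deriv_id[of "chart_at A p" p] by simp
  then show "from_chart A c p (to_chart A c p v) = v" by (metis comp_apply id_apply)
qed

lemma from_chart_linear:
  assumes "c \<in> A" "p \<in> fst c"
  shows "linear (from_chart A c p)"
proof -
  have "p \<in> topspace T" using assms chart_subset by blast
  then show ?thesis
    unfolding from_chart_eq using assms
    by (intro coord_deriv_linear) (auto simp: chart_differentiable_id chart_at_in)
qed

text \<open>Tangent vectors are stored in preferred charts, which may jump from point to point. By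
  the chain rule both sides are the Jacobian from \<open>c\<close> to the preferred chart at
  \<open>f p\<close>, so the calculation can be moved to fixed charts.\<close>

lemma tangent_map_from_chart:
  assumes f: "chart_differentiable f p" and c: "c \<in> A" "p \<in> fst c" and d: "d \<in> A" "f p \<in> fst d"
  shows "tangent_map A A f p (from_chart A c p u) = from_chart A d (f p) (coord_deriv c d f p u)"
proof -
  have p: "p \<in> topspace T" "f p \<in> topspace T" using f by (auto simp: chart_differentiable_def)
  note [simp] = chart_differentiable_id[OF p(1)] chart_differentiable_id[OF p(2)]
    chart_at_in[OF p(1)] chart_at_in[OF p(2)] assms
  have "tangent_map A A f p \<circ> from_chart A c p = coord_deriv c (chart_at A (f p)) f p"
    unfolding tangent_map_eq from_chart_eq
    using coord_deriv_comp[of id p f c "chart_at A p" "chart_at A (f p)"] by simp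
  also have "\<dots> = from_chart A d (f p) \<circ> coord_deriv c d f p"
    unfolding from_chart_eq
    using coord_deriv_comp[of f p id c d "chart_at A (f p)"] by simp
  finally show ?thesis by (metis comp_apply)
qed

lemma from_chart_chart_at:
  assumes "p \<in> topspace T"
  shows "from_chart A (chart_at A p) p = id" "to_chart A (chart_at A p) p = id"
  unfolding from_chart_eq to_chart_eq using coord_deriv_id chart_at_in[OF assms] by auto

end

locale lie_group_manifold = manifold T A for T :: "'m topology" and A :: "('m, 'e::euclidean_space) chart set" +
  fixes G :: "('m, 'r) monoid_scheme" (structure)
  assumes lie_group: "lie_group G T A"
begin

lemma is_group: "group G"
  using lie_group by (simp add: lie_group_def)

sublocale group G by (rule is_group)

lemma topspace_eq: "topspace T = carrier G"
  using lie_group by (simp add: lie_group_def)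

lemma mult_continuous: "continuous_map (prod_topology T T) T (\<lambda>(a, b). a \<otimes> b)"
  using lie_group by (simp add: lie_group_def smooth_map_def)

section \<open>Multiplication and translations in charts\<close>

definition mult_dom :: "('m, 'e) chart \<Rightarrow> ('m, 'e) chart \<Rightarrow> ('m, 'e) chart \<Rightarrow> ('e \<times> 'e) set" where
  "mult_dom c1 c2 d = map_prod (snd c1) (snd c2) ` {(p, q). p \<in> fst c1 \<and> q \<in> fst c2 \<and> p \<otimes> q \<in> fst d}"

definition mult_coord :: "('m, 'e) chart \<Rightarrow> ('m, 'e) chart \<Rightarrow> ('m, 'e) chart \<Rightarrow> 'e \<times> 'e \<Rightarrow> 'e" where
  "mult_coord c1 c2 d = snd d \<circ> (\<lambda>(a, b). a \<otimes> b) \<circ> inv_into (fst c1 \<times> fst c2) (map_prod (snd c1) (snd c2))"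

lemma mult_coord_smooth:
  assumes "c1 \<in> A" "c2 \<in> A" "d \<in> A"
  shows "smooth_on (mult_coord c1 c2 d) (mult_dom c1 c2 d)"
proof -
  define c where "c = (fst c1 \<times> fst c2, map_prod (snd c1) (snd c2))"
  have "c \<in> prod_atlas A A" unfolding prod_atlas_def c_def using assms by blast
  then have "smooth_on (snd d \<circ> (\<lambda>(a, b). a \<otimes> b) \<circ> chart_inv c)
      (snd c ` {p \<in> fst c. (case p of (a, b) \<Rightarrow> a \<otimes> b) \<in> fst d})"
    using lie_group assms(3) unfolding lie_group_def smooth_map_def by blast
  moreover have "{p \<in> fst c. (case p of (a, b) \<Rightarrow> a \<otimes> b) \<in> fst d} =
      {(p, q). p \<in> fst c1 \<and> q \<in> fst c2 \<and> p \<otimes> q \<in> fst d}"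
    by (auto simp: c_def)
  ultimately show ?thesis by (simp add: mult_coord_def mult_dom_def c_def)
qed

lemma mult_dom_open:
  assumes "c1 \<in> A" "c2 \<in> A" "d \<in> A"
  shows "open (mult_dom c1 c2 d)"
proof -
  have "openin (prod_topology T T) {p \<in> topspace (prod_topology T T). (case p of (a, b) \<Rightarrow> a \<otimes> b) \<in> fst d}"
    by (rule openin_continuous_map_preimage[OF mult_continuous chart_openin[OF assms(3)]])
  moreover have "openin (prod_topology T T) (fst c1 \<times> fst c2)"
    using chart_openin assms by (simp add: openin_prod_Times_iff)
  ultimately have "openin (prod_topology T T) ({p \<in> topspace (prod_topology T T). (case p of (a, b) \<Rightarrow> a \<otimes> b) \<in> fst d} \<inter> (fst c1 \<times> fst c2))"
    by (rule openin_Int)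
  moreover have "{p \<in> topspace (prod_topology T T). (case p of (a, b) \<Rightarrow> a \<otimes> b) \<in> fst d} \<inter> (fst c1 \<times> fst c2) =
      {(p, q). p \<in> fst c1 \<and> q \<in> fst c2 \<and> p \<otimes> q \<in> fst d}"
    using chart_subset[OF assms(1)] chart_subset[OF assms(2)] by auto
  ultimately have V: "openin (prod_topology T T) {(p, q). p \<in> fst c1 \<and> q \<in> fst c2 \<and> p \<otimes> q \<in> fst d}"
    by simp
  show ?thesis
    unfolding mult_dom_def
    by (rule open_map_prod_image[OF V, of "fst c1" "fst c2"])
      (use assms chart_openin chart_image_subset_open in auto)
qed

lemma mult_coord_eq:
  assumes "c1 \<in> A" "c2 \<in> A" "p \<in> fst c1" "q \<in> fst c2"
  shows "mult_coord c1 c2 d (snd c1 p, snd c2 q) = snd d (p \<otimes> q)"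
proof -
  have "inj_on (map_prod (snd c1) (snd c2)) (fst c1 \<times> fst c2)"
    by (intro map_prod_inj_on chart_inj assms)
  then have "inv_into (fst c1 \<times> fst c2) (map_prod (snd c1) (snd c2)) (map_prod (snd c1) (snd c2) (p, q)) = (p, q)"
    using assms by (intro inv_into_f_f) auto
  then show ?thesis by (simp add: mult_coord_def)
qed

lemma mult_dom_iff:
  assumes "c1 \<in> A" "c2 \<in> A" "p \<in> fst c1" "q \<in> fst c2"
  shows "(snd c1 p, snd c2 q) \<in> mult_dom c1 c2 d \<longleftrightarrow> p \<otimes> q \<in> fst d"
  unfolding mult_dom_def using assms(3,4)
  by (auto dest: inj_onD[OF chart_inj[OF assms(1)]] inj_onD[OF chart_inj[OF assms(2)]])

text \<open>In coordinates a left translation is a slice of the multiplication, so its derivative is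
  the partial derivative in the second factor.\<close>

lemma left_translation_has_derivative:
  assumes c1: "c1 \<in> A" "a \<in> fst c1" and c: "c \<in> A" "p \<in> fst c" and d: "d \<in> A" "a \<otimes> p \<in> fst d"
  shows "((snd d \<circ> (\<lambda>q. a \<otimes> q) \<circ> chart_inv c) has_derivative
     (\<lambda>u. frechet_derivative (mult_coord c1 c d) (at (snd c1 a, snd c p)) (0, u))) (at (snd c p))"
proof (rule has_derivative_transform_open[OF _ chart_image_open[OF c(1)]])
  have "(snd c1 a, snd c p) \<in> mult_dom c1 c d" using mult_dom_iff assms by simp
  then have "(mult_coord c1 c d has_derivative frechet_derivative (mult_coord c1 c d) (at (snd c1 a, snd c p)))
      (at (snd c1 a, snd c p))"
    using smooth_on_has_derivative[OF mult_coord_smooth] c1 c d by blast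
  then show "((\<lambda>y. mult_coord c1 c d (snd c1 a, y)) has_derivative
     (\<lambda>u. frechet_derivative (mult_coord c1 c d) (at (snd c1 a, snd c p)) (0, u))) (at (snd c p))"
    by (rule has_derivative_compose[OF has_derivative_Pair[OF has_derivative_const has_derivative_ident]])
  show "mult_coord c1 c d (snd c1 a, x) = (snd d \<circ> (\<lambda>q. a \<otimes> q) \<circ> chart_inv c) x" if "x \<in> chart_image c" for x
  proof -
    obtain q where "x = snd c q" "q \<in> fst c" using \<open>x \<in> chart_image c\<close> by (rule imageE)
    then show ?thesis
      using mult_coord_eq[OF c1(1) c(1) c1(2), of q d] chart_inv_chart[OF c(1), of q] by simp
  qed
qed (use c in auto)

lemma right_translation_has_derivative:
  assumes c1: "c1 \<in> A" "a \<in> fst c1" and c: "c \<in> A" "p \<in> fst c" and d: "d \<in> A" "p \<otimes> a \<in> fst d"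
  shows "((snd d \<circ> (\<lambda>q. q \<otimes> a) \<circ> chart_inv c) has_derivative
     (\<lambda>u. frechet_derivative (mult_coord c c1 d) (at (snd c p, snd c1 a)) (u, 0))) (at (snd c p))"
proof (rule has_derivative_transform_open[OF _ chart_image_open[OF c(1)]])
  have "(snd c p, snd c1 a) \<in> mult_dom c c1 d" using mult_dom_iff assms by simp
  then have "(mult_coord c c1 d has_derivative frechet_derivative (mult_coord c c1 d) (at (snd c p, snd c1 a)))
      (at (snd c p, snd c1 a))"
    using smooth_on_has_derivative[OF mult_coord_smooth] c1 c d by blast
  then show "((\<lambda>y. mult_coord c c1 d (y, snd c1 a)) has_derivative
     (\<lambda>u. frechet_derivative (mult_coord c c1 d) (at (snd c p, snd c1 a)) (u, 0))) (at (snd c p))"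
    by (rule has_derivative_compose[OF has_derivative_Pair[OF has_derivative_ident has_derivative_const]])
  show "mult_coord c c1 d (x, snd c1 a) = (snd d \<circ> (\<lambda>q. q \<otimes> a) \<circ> chart_inv c) x" if "x \<in> chart_image c" for x
  proof -
    obtain q where "x = snd c q" "q \<in> fst c" using \<open>x \<in> chart_image c\<close> by (rule imageE)
    then show ?thesis
      using mult_coord_eq[OF c(1) c1(1) _ c1(2), of q d] chart_inv_chart[OF c(1), of q] by simp
  qed
qed (use c in auto)

lemma continuous_chart_nbhd:
  assumes "continuous_map T T f" "p \<in> topspace T" "d \<in> A" "f p \<in> fst d"
  shows "\<exists>V. openin T V \<and> p \<in> V \<and> f ` V \<subseteq> fst d"
  using openin_continuous_map_preimage[OF assms(1) chart_openin[OF assms(3)]] assms(2,4)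
  by (intro exI[of _ "{x \<in> topspace T. f x \<in> fst d}"]) auto

lemma left_translation_chart_differentiable:
  assumes "a \<in> carrier G" "p \<in> carrier G"
  shows "chart_differentiable (\<lambda>q. a \<otimes> q) p"
proof -
  have "continuous_map T (prod_topology T T) (\<lambda>q. (a, q))"
    using assms by (intro continuous_map_pairedI) (auto simp: topspace_eq)
  from continuous_map_compose[OF this mult_continuous]
  have "continuous_map T T (\<lambda>q. a \<otimes> q)" by (simp add: comp_def)
  moreover have "(snd d \<circ> (\<lambda>q. a \<otimes> q) \<circ> chart_inv c) differentiable (at (snd c p))"
    if "c \<in> A" "d \<in> A" "p \<in> fst c" "a \<otimes> p \<in> fst d" for c d
    using left_translation_has_derivative[of "chart_at A a" a c p d] that chart_at_in[of a] assms topspace_eq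
    by (auto simp: differentiable_def)
  ultimately show ?thesis
    unfolding chart_differentiable_def using assms continuous_chart_nbhd by (auto simp: topspace_eq)
qed

lemma right_translation_chart_differentiable:
  assumes "a \<in> carrier G" "p \<in> carrier G"
  shows "chart_differentiable (\<lambda>q. q \<otimes> a) p"
proof -
  have "continuous_map T (prod_topology T T) (\<lambda>q. (q, a))"
    using assms by (intro continuous_map_pairedI) (auto simp: topspace_eq)
  from continuous_map_compose[OF this mult_continuous]
  have "continuous_map T T (\<lambda>q. q \<otimes> a)" by (simp add: comp_def)
  moreover have "(snd d \<circ> (\<lambda>q. q \<otimes> a) \<circ> chart_inv c) differentiable (at (snd c p))"
    if "c \<in> A" "d \<in> A" "p \<in> fst c" "p \<otimes> a \<in> fst d" for c d
    using right_translation_has_derivative[of "chart_at A a" a c p d] that chart_at_in[of a] assms topspace_eq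
    by (auto simp: differentiable_def)
  ultimately show ?thesis
    unfolding chart_differentiable_def using assms continuous_chart_nbhd by (auto simp: topspace_eq)
qed

section \<open>The local group law in the preferred chart at the identity\<close>

definition C :: "('m, 'e) chart" where "C = chart_at A \<one>"

definition e0 :: 'e where "e0 = snd C \<one>"

abbreviation m :: "'e \<times> 'e \<Rightarrow> 'e" where "m \<equiv> mult_coord C C C"

abbreviation W :: "('e \<times> 'e) set" where "W \<equiv> mult_dom C C C"

lemma C_in: "C \<in> A" and one_in_C: "\<one> \<in> fst C"
  using chart_at_in[of \<one>] by (auto simp: C_def topspace_eq)

lemma C_carrier: "p \<in> fst C \<Longrightarrow> p \<in> carrier G"
  using chart_subset[OF C_in] by (auto simp: topspace_eq)

lemma m_eq: "p \<in> fst C \<Longrightarrow> q \<in> fst C \<Longrightarrow> m (snd C p, snd C q) = snd C (p \<otimes> q)"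
  by (rule mult_coord_eq[OF C_in C_in])

lemma W_iff: "p \<in> fst C \<Longrightarrow> q \<in> fst C \<Longrightarrow> (snd C p, snd C q) \<in> W \<longleftrightarrow> p \<otimes> q \<in> fst C"
  by (rule mult_dom_iff[OF C_in C_in])

lemma W_cases:
  assumes "(x, y) \<in> W"
  obtains p q where "x = snd C p" "y = snd C q" "p \<in> fst C" "q \<in> fst C" "p \<otimes> q \<in> fst C"
  using assms by (auto simp: mult_dom_def)

lemma Dm_snd:
  assumes "p \<in> fst C" "q \<in> fst C" "p \<otimes> q \<in> fst C"
  shows "frechet_derivative m (at (snd C p, snd C q)) (0, u) = coord_deriv C C (\<lambda>q. p \<otimes> q) q u"
  unfolding coord_deriv_def
  using has_derivative_frechet_eq[OF left_translation_has_derivative[OF C_in assms(1) C_in assms(2) C_in assms(3)]]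
  by simp

lemma Dm_fst:
  assumes "p \<in> fst C" "q \<in> fst C" "p \<otimes> q \<in> fst C"
  shows "frechet_derivative m (at (snd C p, snd C q)) (u, 0) = coord_deriv C C (\<lambda>p. p \<otimes> q) p u"
  unfolding coord_deriv_def
  using has_derivative_frechet_eq[OF right_translation_has_derivative[OF C_in assms(2) C_in assms(1) C_in assms(3)]]
  by simp

lemma metric_coord_chart:
  "p \<in> fst C \<Longrightarrow> metric_coord A C g (snd C p) u v = g p (from_chart A C p u) (from_chart A C p v)"
  by (simp add: metric_coord_def chart_inv_chart[OF C_in])

text \<open>The two invariance conditions are the nontrivial part: bi-invariance speaks of tangent
  maps in preferred charts, and \<open>tangent_map_from_chart\<close> rewrites these as partial
  derivatives of \<open>m\<close>.\<close>

lemma local_lie_group: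
  assumes riem: "riemannian_metric T A g" and inv: "bi_invariant G A g"
  shows "local_lie_group (chart_image C) e0 W m (metric_coord A C g)"
proof (rule local_lie_group.intro)
  have bil: "bilinear (g p)" and sym: "\<And>u v. g p u v = g p v u" and pos: "\<And>u. u \<noteq> 0 \<Longrightarrow> g p u u > 0"
    if "p \<in> fst C" for p
    using riem C_carrier[OF that] by (auto simp: riemannian_metric_def topspace_eq)
  show "open (chart_image C)" by (rule chart_image_open[OF C_in])
  show "e0 \<in> chart_image C" using one_in_C by (simp add: e0_def)
  show "open W" by (rule mult_dom_open[OF C_in C_in C_in])
  show "W \<subseteq> chart_image C \<times> chart_image C" by (auto simp: mult_dom_def)
  show "smooth_on m W" by (rule mult_coord_smooth[OF C_in C_in C_in])
  show "m w \<in> chart_image C" if "w \<in> W" for w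
    using that by (cases w) (auto elim!: W_cases simp: m_eq)
  show "(x, e0) \<in> W" "m (x, e0) = x" "(e0, x) \<in> W" "m (e0, x) = x" if "x \<in> chart_image C" for x
    using that one_in_C by (auto simp: e0_def W_iff m_eq C_carrier)
  show "m (m (x, y), z) = m (x, m (y, z))"
    if xy: "(x, y) \<in> W" and yz: "(y, z) \<in> W" for x y z
  proof -
    obtain p q where pq: "x = snd C p" "y = snd C q" "p \<in> fst C" "q \<in> fst C" "p \<otimes> q \<in> fst C"
      using xy by (rule W_cases)
    obtain q' r where qr: "y = snd C q'" "z = snd C r" "q' \<in> fst C" "r \<in> fst C" "q' \<otimes> r \<in> fst C"
      using yz by (rule W_cases)
    \<comment> \<open>The middle factor is obtained once from each pair; injectivity of the chart
      identifies the two.\<close>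
    have "q' = q" using pq qr chart_inj[OF C_in] by (simp add: inj_on_eq_iff)
    then show ?thesis using pq qr by (simp add: m_eq m_assoc C_carrier)
  qed
  show "metric_coord A C g x u v = metric_coord A C g x v u" if "x \<in> chart_image C" for x u v
    using that sym by (auto simp: metric_coord_chart)
  show "metric_coord A C g x u u > 0" if x: "x \<in> chart_image C" and u: "u \<noteq> 0" for x u
  proof -
    obtain p where p: "x = snd C p" "p \<in> fst C" using x by auto
    have "from_chart A C p u \<noteq> 0"
      using to_chart_from_chart(1)[OF C_in p(2), of u] to_chart_from_chart(1)[OF C_in p(2), of 0]
        linear_0[OF from_chart_linear[OF C_in p(2)]] u by metis
    then show ?thesis using p pos by (simp add: metric_coord_chart)
  qed
  show "bilinear (metric_coord A C g x)" if x: "x \<in> chart_image C" for x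
  proof -
    obtain p where p: "x = snd C p" "p \<in> fst C" using x by auto
    note lin = linear_add[OF from_chart_linear[OF C_in p(2)]] linear_scale[OF from_chart_linear[OF C_in p(2)]]
    show ?thesis
      unfolding bilinear_def p(1)
      by (auto intro!: linearI simp: metric_coord_chart[OF p(2)] lin
          bilinear_ladd[OF bil[OF p(2)]] bilinear_radd[OF bil[OF p(2)]]
          bilinear_lmul[OF bil[OF p(2)]] bilinear_rmul[OF bil[OF p(2)]])
  qed
  show "(\<lambda>x. metric_coord A C g x u v) differentiable (at x)" if "x \<in> chart_image C" for x u v
    using riem C_in smooth_on_differentiable that unfolding riemannian_metric_def by blast
  show "metric_coord A C g (m (x, y)) (frechet_derivative m (at (x, y)) (0, u)) (frechet_derivative m (at (x, y)) (0, v)) =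
      metric_coord A C g y u v" if xy: "(x, y) \<in> W" for x y u v
  proof -
    obtain p q where pq: "x = snd C p" "y = snd C q" "p \<in> fst C" "q \<in> fst C" "p \<otimes> q \<in> fst C"
      using xy by (rule W_cases)
    have t: "tangent_map A A (\<lambda>q. p \<otimes> q) q (from_chart A C q u) =
        from_chart A C (p \<otimes> q) (coord_deriv C C (\<lambda>q. p \<otimes> q) q u)" for u
      by (rule tangent_map_from_chart[OF left_translation_chart_differentiable]) (use pq C_in C_carrier in auto)
    have "g (p \<otimes> q) (tangent_map A A (\<lambda>q. p \<otimes> q) q (from_chart A C q u))
         (tangent_map A A (\<lambda>q. p \<otimes> q) q (from_chart A C q v)) = g q (from_chart A C q u) (from_chart A C q v)"
      using inv C_carrier pq unfolding bi_invariant_def by blast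
    then show ?thesis using pq by (simp add: m_eq metric_coord_chart Dm_snd t)
  qed
  show "metric_coord A C g (m (x, y)) (frechet_derivative m (at (x, y)) (u, 0)) (frechet_derivative m (at (x, y)) (v, 0)) =
      metric_coord A C g x u v" if xy: "(x, y) \<in> W" for x y u v
  proof -
    obtain p q where pq: "x = snd C p" "y = snd C q" "p \<in> fst C" "q \<in> fst C" "p \<otimes> q \<in> fst C"
      using xy by (rule W_cases)
    have t: "tangent_map A A (\<lambda>p. p \<otimes> q) p (from_chart A C p u) =
        from_chart A C (p \<otimes> q) (coord_deriv C C (\<lambda>p. p \<otimes> q) p u)" for u
      by (rule tangent_map_from_chart[OF right_translation_chart_differentiable]) (use pq C_in C_carrier in auto)
    have "g (p \<otimes> q) (tangent_map A A (\<lambda>p. p \<otimes> q) p (from_chart A C p u))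
         (tangent_map A A (\<lambda>p. p \<otimes> q) p (from_chart A C p v)) = g p (from_chart A C p u) (from_chart A C p v)"
      using inv C_carrier pq unfolding bi_invariant_def by blast
    then show ?thesis using pq by (simp add: m_eq metric_coord_chart Dm_fst t)
  qed
qed

text \<open>The bridge from invariant fields on the group to the frame of the local group law. At
  the identity the preferred chart is \<open>C\<close>, so there \<open>from_chart\<close> is the
  identity map.\<close>

lemma to_chart_left_extension:
  assumes p: "p \<in> fst C"
  shows "to_chart A C p (left_extension G A a p) = frechet_derivative m (at (snd C p, e0)) (0, a)"
proof -
  have "left_extension G A a p = tangent_map A A (\<lambda>q. p \<otimes> q) \<one> (from_chart A C \<one> a)"
    unfolding left_extension_def using from_chart_chart_at(1)[of \<one>] by (simp add: C_def topspace_eq)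
  also have "\<dots> = from_chart A C (p \<otimes> \<one>) (coord_deriv C C (\<lambda>q. p \<otimes> q) \<one> a)"
    by (rule tangent_map_from_chart[OF left_translation_chart_differentiable])
      (use p C_in one_in_C C_carrier in auto)
  also have "\<dots> = from_chart A C p (frechet_derivative m (at (snd C p, e0)) (0, a))"
    using p one_in_C C_carrier by (simp add: e0_def Dm_snd)
  finally show ?thesis using to_chart_from_chart(1)[OF C_in p] by simp
qed

lemma field_coord_left_extension:
  assumes "x \<in> chart_image C"
  shows "field_coord A C (left_extension G A a) x = frechet_derivative m (at (x, e0)) (0, a)"
proof -
  obtain p where p: "x = snd C p" "p \<in> fst C" using assms by auto
  then show ?thesis
    unfolding field_coord_def using to_chart_left_extension[OF p(2)] chart_inv_chart[OF C_in p(2)] by simp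
qed

end

theorem theorem2p3:
  fixes G :: "('m, 'r) monoid_scheme"
    and T :: "'m topology"
    and A :: "('m, 'e::euclidean_space) chart set"
    and g :: "'m \<Rightarrow> 'e \<Rightarrow> 'e \<Rightarrow> real"
    and Xf :: "'m \<Rightarrow> 'e"
    and X Y U :: 'e
    and P :: "'e set"
    and ip :: "'e \<Rightarrow> 'e \<Rightarrow> real"
    and br :: "'e \<Rightarrow> 'e \<Rightarrow> 'e"
  assumes "lie_group G T A"
    and "riemannian_metric T A g"
    and "bi_invariant G A g"
    and "smooth_vector_field A Xf"
    and "left_invariant G A Xf"
    and "parallel_field T A g Xf"
    and "\<forall>p\<in>carrier G. sqrt (g p (Xf p) (Xf p)) < 1 / 2"
    and X: "X = Xf \<one>\<^bsub>G\<^esub>"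
    and ip: "ip = g \<one>\<^bsub>G\<^esub>"
    and br: "br = lie_bracket G A"
    and "is_flag P Y"
    and "P = span {Y, U}"
    and "ip Y Y = 1" and "ip U U = 1" and "ip Y U = 0"
  shows "flag_curvature A (matsumoto_metric g Xf) \<one>\<^bsub>G\<^esub> P Y =
      - (1 - ip Y X)\<^sup>2 / (4 * (1 - ip Y X) * (1 - 2 * ip Y X) + 8 * (ip U X)\<^sup>2) *
      (ip (br (br U Y) Y) U * (1 - ip Y X) * (1 - 2 * ip Y X)
       + 3 * ip (br (br U Y) Y) X * ip U X)"
proof -
  have "smooth_manifold T A" using assms(1) by (simp add: lie_group_def)
  then interpret M: lie_group_manifold T A G
    by (intro lie_group_manifold.intro manifold.intro lie_group_manifold_axioms.intro assms(1))
  define h where "h = metric_coord A M.C g"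
  define F where "F = matsumoto_metric g Xf"
  define L where "L = finsler_coord A M.C F"
  interpret N: local_lie_group "chart_image M.C" M.e0 M.W M.m h
    unfolding h_def by (rule M.local_lie_group[OF assms(2,3)])
  have one: "\<one>\<^bsub>G\<^esub> \<in> topspace T" by (simp add: M.topspace_eq)
  have h_base: "h M.e0 = ip"
    unfolding h_def M.e0_def ip fun_eq_iff
    using M.metric_coord_chart[OF M.one_in_C] M.from_chart_chart_at(1)[OF one] by (simp add: M.C_def)
  have E: "field_coord A M.C (left_extension G A a) x = N.E x a" if "x \<in> chart_image M.C" for x a
    unfolding N.E_def by (rule M.field_coord_left_extension[OF that])
  \<comment> \<open>A left invariant field is recovered from its value at the identity by left
    translation.\<close>
  have Xf: "Xf p = left_extension G A X p" if "p \<in> carrier G" for p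
  proof -
    have "tangent_map A A (\<lambda>q. p \<otimes>\<^bsub>G\<^esub> q) \<one>\<^bsub>G\<^esub> (Xf \<one>\<^bsub>G\<^esub>) = Xf (p \<otimes>\<^bsub>G\<^esub> \<one>\<^bsub>G\<^esub>)"
      using assms(5) that M.one_closed unfolding left_invariant_def by blast
    then show ?thesis using that by (simp add: left_extension_def X)
  qed
  have Xf_E: "field_coord A M.C Xf x = N.E x X" if "x \<in> chart_image M.C" for x
  proof -
    have "chart_inv M.C x \<in> carrier G" using that M.C_carrier by (auto simp: inv_into_into)
    then show ?thesis using E[OF that, of X] by (simp add: field_coord_def Xf)
  qed
  have br_eq: "lie_bracket G A = N.br"
  proof (intro ext)
    fix u v
    have "frechet_derivative (field_coord A M.C (left_extension G A a)) (at M.e0) =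
        frechet_derivative (\<lambda>x. N.E x a) (at M.e0)" for a
      by (rule frechet_derivative_cong_open[OF N.S_open N.e0_in E])
    then show "lie_bracket G A u v = N.br u v"
      unfolding lie_bracket_def field_bracket_def N.br_def
      using E[OF N.e0_in] by (simp add: coord_bracket_def M.C_def[symmetric] M.e0_def[symmetric] Let_def)
  qed
  have frame: "invariant_frame (h M.e0) X (chart_image M.C) M.e0 N.E N.th N.br L"
  proof (rule N.invariant_frameI)
    show "sqrt (h M.e0 X X) < 1 / 2"
      unfolding h_base ip X using assms(7) M.one_closed by blast
    show "frechet_derivative (\<lambda>z. N.E z X) (at M.e0) v + levi_civita_symbol h M.e0 v X = 0" for v
    proof -
      have "frechet_derivative (field_coord A M.C Xf) (at M.e0) = frechet_derivative (\<lambda>z. N.E z X) (at M.e0)"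
        by (rule frechet_derivative_cong_open[OF N.S_open N.e0_in Xf_E])
      moreover have "levi_civita_deriv A g \<one>\<^bsub>G\<^esub> v Xf = 0"
        using assms(6) one by (simp add: parallel_field_def)
      ultimately show ?thesis
        unfolding levi_civita_deriv_def
        by (simp add: Let_def M.C_def[symmetric] M.e0_def[symmetric] Xf_E[OF N.e0_in] N.E_base h_def)
    qed
    show "L x y = h x y y / (sqrt (h x y y) - h x (N.E x X) y)" if x: "x \<in> chart_image M.C" for x y
    proof -
      obtain p where p: "x = snd M.C p" "p \<in> fst M.C" using x by auto
      have inv: "chart_inv M.C x = p" using M.chart_inv_chart[OF M.C_in] p by simp
      have "Xf p = from_chart A M.C p (N.E x X)"
        using M.to_chart_from_chart(2)[OF M.C_in p(2), of "Xf p"] Xf_E[OF x]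
        by (simp add: field_coord_def inv)
      \<comment> \<open>The Matsumoto numerator is the square of a square root; nonnegativity of the
        form lets it be replaced by \<open>h x y y\<close>.\<close>
      moreover have "h x y y \<ge> 0"
        using inner_form.ip_nonneg[OF N.inner_form[OF x]] .
      ultimately show ?thesis
        unfolding L_def F_def finsler_coord_def matsumoto_metric_def Let_def inv h_def metric_coord_def
        by simp
    qed
  qed
  interpret I: invariant_frame ip X "chart_image M.C" M.e0 N.E N.th N.br L
    using frame by (simp only: h_base)
  \<comment> \<open>At the identity both the passage to the chart and the inverse frame are the
    identity map, so the metric there is literally the Minkowski norm analysed above.\<close>
  have "F \<one>\<^bsub>G\<^esub> = I.norm_fun"
  proof
    fix y
    have "L M.e0 y = F \<one>\<^bsub>G\<^esub> y"
      unfolding L_def finsler_coord_def M.e0_def Let_def M.chart_inv_chart[OF M.C_in M.one_in_C]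
      using M.from_chart_chart_at(1)[OF one] by (simp add: M.C_def)
    then show "F \<one>\<^bsub>G\<^esub> y = I.norm_fun y"
      using I.L_eq[OF I.e0_in, of y] by (simp add: I.th_base)
  qed
  moreover have "flag_operator A F \<one>\<^bsub>G\<^esub> Y V = chern_curvature L (\<lambda>_. V) (\<lambda>_. Y) (\<lambda>_. Y) M.e0 Y" for V
    unfolding flag_operator_def L_def by (simp add: Let_def M.C_def M.e0_def)
  ultimately show ?thesis
    unfolding \<open>P = span {Y, U}\<close> br br_eq F_def[symmetric]
    by (rule I.flag_curvature_eq) (rule assms)+
qed

end
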